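(* There is a compact set $E\subset\mathbb{R}^3$ such that $\dim(E)=\dim_{QC}(E)=2$ but $\dim_H(E)=0$.
   Context: Here $\dim$ denotes Hausdorff dimension. Let $H(\mathbb{R}^d)$ be the collection of homeomorphisms of $\mathbb{R}^d$ to itself and $QCH(\mathbb{R}^d)$ the subset of quasiconformal homeomorphisms, i.e. those $f\in H(\mathbb{R}^d)$ for which there is $M<\infty$ with $$\limsup_{r\to0}\frac{\sup_{|x-y|=r}|f(x)-f(y)|}{\inf_{|x-y|=r}|f(x)-f(y)|}\le M\quad\text{for all }x\in\mathbb{R}^d.$$ For $E\subset\mathbb{R}^d$ define $$\dim_H(E)=\inf_{f\in H(\mathbb{R}^d)}\dim(f(E)),\qquad \dim_{QC}(E)=\inf_{f\in QCH(\mathbb{R}^d)}\dim(f(E)).$$ (Note that $\dim_H$ is this infimum over homeomorphisms, not the Hausdorff dimension.) *)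

theory Defs
  imports "HOL-Analysis.Analysis"
begin

text \<open>
  The \<open>s\<close>-th power of the diameter, with the usual conventions \<open>diam(U)^0 = 1\<close> for
  \<open>U \<noteq> {}\<close> and \<open>diam({})^s = 0\<close>; \<open>powr\<close> alone would give \<open>0 powr 0 = 0\<close>.
\<close>
definition diam_pow :: "real \<Rightarrow> 'a::metric_space set \<Rightarrow> ennreal" where
  "diam_pow s U =
     (if U = {} then 0 else if s = 0 then 1 else ennreal (diameter U powr s))"

text \<open>
  Finite covers are included, as \<open>U i\<close> may be empty. Boundedness is required because
  \<^const>\<open>diameter\<close> is only meaningful on bounded sets.
\<close>
definition delta_covers :: "real \<Rightarrow> 'a::metric_space set \<Rightarrow> (nat \<Rightarrow> 'a set) set" where
  "delta_covers \<delta> E =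
     {U. E \<subseteq> (\<Union>i. U i) \<and> (\<forall>i. bounded (U i) \<and> diameter (U i) \<le> \<delta>)}"

definition hausdorff_premeasure :: "real \<Rightarrow> real \<Rightarrow> 'a::metric_space set \<Rightarrow> ennreal" where
  "hausdorff_premeasure s \<delta> E = (INF U\<in>delta_covers \<delta> E. \<Sum>i. diam_pow s (U i))"

definition hausdorff_outer_measure :: "real \<Rightarrow> 'a::metric_space set \<Rightarrow> ennreal" where
  "hausdorff_outer_measure s E = (SUP \<delta>\<in>{0<..}. hausdorff_premeasure s \<delta> E)"

definition hausdorff_dim :: "'a::metric_space set \<Rightarrow> ennreal" where
  "hausdorff_dim E = (INF s\<in>{s. 0 \<le> s \<and> hausdorff_outer_measure s E = 0}. ennreal s)"

definition self_homeos :: "('a::euclidean_space \<Rightarrow> 'a) set" where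
  "self_homeos = {f. \<exists>g. homeomorphism UNIV UNIV f g}"

definition metric_dilatation ::
    "('a::euclidean_space \<Rightarrow> 'a) \<Rightarrow> 'a \<Rightarrow> real \<Rightarrow> ennreal" where
  "metric_dilatation f x r =
     (SUP y\<in>sphere x r. ennreal (dist (f x) (f y))) /
     (INF y\<in>sphere x r. ennreal (dist (f x) (f y)))"

definition qc_homeos :: "('a::euclidean_space \<Rightarrow> 'a) set" where
  "qc_homeos =
     {f \<in> self_homeos. \<exists>M<\<infinity>. \<forall>x. Limsup (at_right 0) (metric_dilatation f x) \<le> M}"

definition homeo_dim :: "'a::euclidean_space set \<Rightarrow> ennreal" where
  "homeo_dim E = (INF f\<in>self_homeos. hausdorff_dim (f ` E))"

definition qc_dim :: "'a::euclidean_space set \<Rightarrow> ennreal" where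
  "qc_dim E = (INF f\<in>qc_homeos. hausdorff_dim (f ` E))"

end

theory Submission
  imports Defs "HOL-Library.Sublist" "HOL-Real_Asymp.Real_Asymp"
begin

text \<open>
  The set is \<open>E = K \<times> K \<times> {0}\<close> for a Cantor set \<open>K\<close> of positive length whose gaps shrink
  doubly exponentially relative to the intervals that they split.

  Homeomorphisms do not see the positive length: a homeomorphism of the line that collapses exactly
  the length of \<open>K\<close> turns the intervals of generation \<open>n\<close> into intervals of length at most
  \<open>excess n\<close>, which is so small that the image of \<open>E\<close> under the induced map of space
  (\<open>squeeze_plane\<close>) has dimension \<open>0\<close>.

  For quasiconformal \<open>f\<close> the point is that \<open>f(E)\<close> has positive two-dimensional Hausdorff measure.
  The metric definition gives, at each point, a scale below which the dilatation is bounded, but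
  this scale depends on the point. By Baire's theorem, applied to the compact set \<open>E\<close> and not to the
  whole space, one scale and one bound \<open>H\<close> serve for all centres in a relatively open piece of \<open>E\<close>
  (\<open>qc_weak_qs_portion\<close>). From there on, \<open>f\<close> enters only as a homeomorphism with this weak
  quasisymmetry centred at points of \<open>E\<close>.

  Such an \<open>f\<close> cannot tear \<open>K\<close> apart much: the approach to the edge of a gap of generation \<open>n\<close>
  contains \<open>8 ^ n\<close> points of \<open>K\<close> at geometrically decreasing distances, none of them closer
  to the edge than the gap is wide. Their images are separated by about the size of the image of the
  gap, and volume in three dimensions bounds the latter by \<open>1 / 2 ^ n\<close> times the image of the
  adjacent interval (\<open>gap_image_le\<close>). These factors are summable, so along every line the images of
  the intervals alone carry a definite amount of length. Averaging over parallel lines and using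
  the Cauchy-Schwarz inequality on the four children of each square, this is a discrete form of the
  length-area argument: in every cover of the piece by construction squares, the squared image sizes
  have sum bounded below (\<open>tree_energy\<close>). Finally each small ball in the image can be traded for a
  bounded number of construction squares whose image sizes are at most a constant times its radius
  (\<open>ball_squares\<close>), which bounds the sum of squared diameters in every cover of \<open>f(E)\<close>.
\<close>

section \<open>A Cantor set of positive length with doubly exponentially small gaps\<close>

text \<open>
  The exponent \<open>8 ^ n\<close> has two uses: it leaves room for \<open>8 ^ n\<close> halvings between the size of an
  interval and the size of its gap, where \<open>8\<close> is \<open>2 ^ d\<close> for the dimension \<open>d = 3\<close> of the space, and
  it makes \<open>4 ^ n * excess n powr s\<close> tend to \<open>0\<close> for every \<open>s > 0\<close>.
\<close>
definition excess :: "nat \<Rightarrow> real" where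
  "excess n = (1/2) ^ (n + 1 + 8 ^ n)"

text \<open>
  The length of an interval of generation \<open>n\<close>. The first summand is the length of the part of the
  Cantor set inside it, the second one the total length of the gaps inside it.
\<close>
definition len :: "nat \<Rightarrow> real" where
  "len n = (1/2) ^ n + excess n"

text \<open>
  An interval of the construction is coded by the word of left/right choices leading to it, the
  latest choice first. Descendants of \<open>w\<close> are thus the words with suffix \<open>w\<close>.
\<close>
primrec lft :: "bool list \<Rightarrow> real" where
  "lft [] = 0"
| "lft (b # w) = lft w + (if b then len (length w) - len (Suc (length w)) else 0)"

definition cell :: "bool list \<Rightarrow> real set" where
  "cell w = {lft w .. lft w + len (length w)}"

definition cantor :: "real set" where
  "cantor = {x. \<forall>n. \<exists>w. length w = n \<and> x \<in> cell w}"

lemma excess_pos: "0 < excess n"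
  by (simp add: excess_def)

lemma excess_Suc: "2 * excess (Suc n) < excess n"
proof -
  have "n + 1 + 8 ^ n < n + 1 + (8::nat) ^ Suc n" by simp
  then have "(1/2::real) ^ (n + 1 + 8 ^ Suc n) < (1/2) ^ (n + 1 + 8 ^ n)"
    by (intro power_strict_decreasing) auto
  then show ?thesis by (simp add: excess_def)
qed

lemma excess_le: "excess n \<le> (1/2) ^ n"
  unfolding excess_def by (intro power_decreasing) auto

lemma len_ge: "(1/2) ^ n \<le> len n"
  using excess_pos[of n] by (simp add: len_def)

lemma len_le: "len n \<le> 2 * (1/2) ^ n"
  using excess_le[of n] by (simp add: len_def)

lemma len_pos: "0 < len n"
  using len_ge[of n] by (meson less_le_trans zero_less_divide_1_iff zero_less_numeral zero_less_power)

lemma len_Suc: "2 * len (Suc n) < len n"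
  using excess_Suc[of n] by (simp add: len_def)

lemma len_less: "i < j \<Longrightarrow> 2 * len j < len i"
proof (induction j)
  case (Suc j)
  show ?case
  proof (cases "i = j")
    case True then show ?thesis by (simp add: len_Suc)
  next
    case False
    with Suc have "2 * len j < len i" by simp
    moreover have "2 * len (Suc j) < len j" by (rule len_Suc)
    ultimately show ?thesis using len_pos[of j] by linarith
  qed
qed simp

lemma len_antimono: "i \<le> j \<Longrightarrow> len j \<le> len i"
  using len_less[of i j] len_pos[of j] by (cases "i = j") auto

lemma len_tendsto_0: "len \<longlonglongrightarrow> 0"
proof (rule tendsto_sandwich[OF _ _ tendsto_const])
  show "(\<lambda>n. 2 * (1/2) ^ n :: real) \<longlonglongrightarrow> 0"
    by (intro tendsto_mult_right_zero LIMSEQ_realpow_zero) auto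
qed (auto intro!: eventuallyI len_le less_imp_le[OF len_pos])

text \<open>
  Hence \<open>8 ^ n\<close> further generations fit between a child and the gap next to it; this is where the
  doubly exponential decay of \<open>excess\<close> is used.
\<close>
lemma gap_le: "len n - 2 * len (Suc n) \<le> len (Suc n + 8 ^ n)"
proof -
  have "len n - 2 * len (Suc n) \<le> excess n"
    using excess_pos[of "Suc n"] by (simp add: len_def)
  also have "\<dots> = (1/2) ^ (Suc n + 8 ^ n)" by (simp add: excess_def)
  also have "\<dots> \<le> len (Suc n + 8 ^ n)" by (rule len_ge)
  finally show ?thesis .
qed

lemma cell_Cons: "cell (b # w) \<subseteq> cell w"
  using len_Suc[of "length w"] len_pos[of "length w"] len_pos[of "Suc (length w)"]
  by (auto simp: cell_def)

lemma cell_append: "cell (p @ w) \<subseteq> cell w"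
proof (induction p)
  case (Cons b p)
  then show ?case using cell_Cons[of b "p @ w"] by auto
qed simp

lemma lft_in_cell: "lft w \<in> cell w"
  and rgt_in_cell: "lft w + len (length w) \<in> cell w"
  using len_pos[of "length w"] by (auto simp: cell_def)

text \<open>
  Distinct intervals of one generation are disjoint; by induction, the offset between two children
  of one interval exceeds the length of a child, and an offset between parents loses at most the
  amount by which the length drops.
\<close>
lemma lft_separated:
  "length w = length w' \<Longrightarrow> w \<noteq> w' \<Longrightarrow> len (length w) < \<bar>lft w - lft w'\<bar>"
proof (induction w w' rule: list_induct2)
  case (Cons b w b' w')
  define n where "n = length w"
  have n: "length w' = n" "length w = n" using Cons by (auto simp: n_def)
  show ?case
  proof (cases "w = w'")
    case True
    then have "b \<noteq> b'" using Cons by auto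
    then show ?thesis using True len_Suc[of n] by (auto simp: n abs_if)
  next
    case False
    then have "len n < \<bar>lft w - lft w'\<bar>" using Cons n by auto
    then show ?thesis using len_Suc[of n] len_pos[of "Suc n"]
      by (auto simp: n abs_if split: if_splits)
  qed
qed simp

lemma cell_inj:
  assumes "length w = length w'" "x \<in> cell w" "x \<in> cell w'"
  shows "w = w'"
proof (rule ccontr)
  assume "w \<noteq> w'"
  from lft_separated[OF assms(1) this] assms show False
    by (auto simp: cell_def abs_if split: if_splits)
qed

lemma cell_extends:
  assumes "x \<in> cell w" "x \<in> cell w'" "length w \<le> length w'"
  shows "suffix w w'"
proof -
  define p where "p = take (length w' - length w) w'"
  define v where "v = drop (length w' - length w) w'"
  have w': "w' = p @ v" by (simp add: p_def v_def)
  have "length v = length w" using assms(3) by (simp add: v_def)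
  moreover have "x \<in> cell v" using assms(2) cell_append[of p v] w' by auto
  ultimately have "v = w" using assms(1) cell_inj by blast
  then show ?thesis using w' by (auto simp: suffix_def)
qed

lemma cantor_subset: "cantor \<subseteq> cell []"
  by (auto simp: cantor_def)

lemma cantor_child:
  assumes "x \<in> cantor" "x \<in> cell w"
  obtains b where "x \<in> cell (b # w)"
proof -
  obtain w' where w': "length w' = Suc (length w)" "x \<in> cell w'"
    using assms(1) by (auto simp: cantor_def)
  then obtain p where p: "w' = p @ w"
    using cell_extends[OF assms(2), of w'] by (auto simp: suffix_def)
  then have "length p = 1" using w' by simp
  then obtain b where "p = [b]" by (auto simp: length_Suc_conv)
  then show ?thesis using that p w' by auto
qed

text \<open>
  Membership need only be checked below a single word, since the ancestors of an interval contain
  it.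
\<close>
lemma in_cantorI:
  assumes "\<And>k. \<exists>p. length p = k \<and> x \<in> cell (p @ w)"
  shows "x \<in> cantor"
  unfolding cantor_def
proof (intro CollectI allI)
  fix n
  obtain p where p: "length p = n" "x \<in> cell (p @ w)" using assms by blast
  define q where "q = take (length w) (p @ w)"
  define v where "v = drop (length w) (p @ w)"
  have "p @ w = q @ v" unfolding q_def v_def by (simp only: append_take_drop_id)
  then have "x \<in> cell v" using p cell_append[of q v] by auto
  moreover have "length v = n" using p by (simp add: v_def)
  ultimately show "\<exists>w. length w = n \<and> x \<in> cell w" by blast
qed

lemma lft_replicate_False: "lft (replicate k False @ w) = lft w"
  by (induction k) auto

lemma rgt_replicate_True:
  "lft (replicate k True @ w) + len (k + length w) = lft w + len (length w)"
  by (induction k) auto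

lemma lft_in_cantor: "lft w \<in> cantor"
proof (rule in_cantorI[of _ w])
  fix k
  show "\<exists>p. length p = k \<and> lft w \<in> cell (p @ w)"
    by (rule exI[of _ "replicate k False"])
       (metis length_replicate lft_replicate_False lft_in_cell)
qed

lemma rgt_in_cantor: "lft w + len (length w) \<in> cantor"
proof (rule in_cantorI[of _ w])
  fix k
  show "\<exists>p. length p = k \<and> lft w + len (length w) \<in> cell (p @ w)"
    by (rule exI[of _ "replicate k True"])
       (metis length_replicate length_append rgt_replicate_True rgt_in_cell)
qed

lemma finite_words: "finite {w :: bool list. length w = n}"
  using finite_lists_length_eq[of "UNIV :: bool set" n] by simp

lemma card_words: "card {w :: bool list. length w = n} = 2 ^ n"
  using card_lists_length_eq[of "UNIV :: bool set" n] by simp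

lemma compact_cantor: "compact cantor"
proof -
  have "cantor = (\<Inter>n. \<Union>w\<in>{w. length w = n}. cell w)"
    by (auto simp: cantor_def)
  moreover have "closed (\<Inter>n. \<Union>w\<in>{w. length w = n}. cell w)"
    by (intro closed_INT ballI closed_UN finite_words) (auto simp: cell_def)
  ultimately have "closed cantor" by simp
  moreover have "bounded cantor"
    using cantor_subset bounded_subset[of "cell []"] by (auto simp: cell_def)
  ultimately show ?thesis using compact_eq_bounded_closed by blast
qed

section \<open>Weakly quasisymmetric maps do not open gaps\<close>

definition pt :: "real \<Rightarrow> real \<Rightarrow> real ^ 3" where
  "pt a b = vector [a, b, 0]"

lemma dist_pt: "dist (pt a b) (pt a' b') = sqrt ((a - a')\<^sup>2 + (b - b')\<^sup>2)"
  by (simp add: dist_vec_def L2_set_def sum_3 pt_def dist_real_def)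

lemma dist_pt_same [simp]: "dist (pt a b) (pt a b') = \<bar>b - b'\<bar>"
  by (simp add: dist_pt)

lemma dist_pt_le: "dist (pt a b) (pt a' b') \<le> \<bar>a - a'\<bar> + \<bar>b - b'\<bar>"
  by (simp add: dist_pt sqrt_sum_squares_le_sum_abs)

lemma fst_le_dist_pt: "\<bar>a - a'\<bar> \<le> dist (pt a b) (pt a' b')"
  and snd_le_dist_pt: "\<bar>b - b'\<bar> \<le> dist (pt a b) (pt a' b')"
  by (simp_all add: dist_pt real_le_rsqrt)

lemma continuous_on_pt [continuous_intros]:
  assumes "continuous_on S g" "continuous_on S h"
  shows "continuous_on S (\<lambda>x. pt (g x) (h x))"
proof -
  have "pt a b = a *\<^sub>R pt 1 0 + b *\<^sub>R pt 0 1" for a b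
    by (simp add: vec_eq_iff forall_3 pt_def)
  then have eq: "(\<lambda>x. pt (g x) (h x)) = (\<lambda>x. g x *\<^sub>R pt 1 0 + h x *\<^sub>R pt 0 1)" by blast
  show ?thesis unfolding eq by (intro continuous_intros assms)
qed

text \<open>
  The balls of radius \<open>r\<close> around the points are disjoint and lie in the ball of radius \<open>R + r\<close>;
  compare volumes.
\<close>
lemma packing:
  fixes x :: "nat \<Rightarrow> 'a::euclidean_space"
  assumes sep: "\<And>i j. i < j \<Longrightarrow> j < N \<Longrightarrow> 2 * r \<le> dist (x i) (x j)"
    and sub: "\<And>i. i < N \<Longrightarrow> dist (x i) c \<le> R" and "0 < r" "0 \<le> R"
  shows "real N * r ^ DIM('a) \<le> (R + r) ^ DIM('a)"
proof -
  define V where "V = measure lborel (ball (0::'a) 1)"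
  have V: "0 < V" unfolding V_def by (rule content_ball_pos) simp
  have vol: "measure lborel (ball z s) = s ^ DIM('a) * V" if "0 \<le> s" for z :: 'a and s
    unfolding V_def by (rule content_ball_conv_unit_ball[OF that])
  have "ball (x i) r \<inter> ball (x j) r = {}" if "i < j" "j < N" for i j
  proof (rule ccontr)
    assume "ball (x i) r \<inter> ball (x j) r \<noteq> {}"
    then obtain z where "dist (x i) z < r" "dist (x j) z < r" by auto
    then have "dist (x i) (x j) < 2 * r"
      using dist_triangle2[of "x i" "x j" z] by simp
    with sep[OF that] show False by simp
  qed
  then have disj: "disjoint_family_on (\<lambda>i. ball (x i) r) {..<N}"
    unfolding disjoint_family_on_def by (metis Int_commute lessThan_iff nat_neq_iff)
  have "real N * (r ^ DIM('a) * V) = (\<Sum>i<N. measure lborel (ball (x i) r))"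
    using \<open>0 < r\<close> by (simp add: vol)
  also have "\<dots> = measure lborel (\<Union>i<N. ball (x i) r)"
    using disj by (intro measure_finite_Union[symmetric]) (use emeasure_lborel_ball_finite in \<open>auto simp: less_top\<close>)
  also have "\<dots> \<le> measure lborel (ball c (R + r))"
  proof (rule measure_mono_fmeasurable)
    show "(\<Union>i<N. ball (x i) r) \<subseteq> ball c (R + r)"
    proof safe
      fix i z assume "i < N" "z \<in> ball (x i) r"
      then show "z \<in> ball c (R + r)"
        using sub[of i] dist_triangle[of c z "x i"] by (auto simp: dist_commute)
    qed
  qed (use emeasure_lborel_ball_finite in \<open>auto simp: fmeasurable_def\<close>)
  also have "\<dots> = (R + r) ^ DIM('a) * V"
    using assms by (simp add: vol)
  finally show ?thesis using V by (simp add: mult.assoc[symmetric])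
qed

text \<open>
  Weak quasisymmetry with constant \<open>H\<close> up to scale \<open>\<rho>\<close>, at a single centre. The centre will range
  over a part of the Cantor product only, while the compared points are arbitrary.
\<close>
definition weak_qs_at :: "('a::metric_space \<Rightarrow> 'b::metric_space) \<Rightarrow> real \<Rightarrow> real \<Rightarrow> 'a \<Rightarrow> bool" where
  "weak_qs_at f H \<rho> x \<longleftrightarrow>
     (\<forall>y z. dist y x \<le> dist z x \<longrightarrow> dist z x < \<rho> \<longrightarrow> dist (f y) (f x) \<le> H * dist (f z) (f x))"

lemma weak_qs_atD:
  "weak_qs_at f H \<rho> x \<Longrightarrow> dist y x \<le> dist z x \<Longrightarrow> dist z x < \<rho> \<Longrightarrow>
     dist (f y) (f x) \<le> H * dist (f z) (f x)"
  by (auto simp: weak_qs_at_def)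

text \<open>
  The distance of the images of the end points of the segment over the interval \<open>v\<close> in the
  column with first coordinate \<open>a\<close>. Only end points are compared, as these lie in the Cantor set
  and the triangle inequality across a gap then needs nothing else.
\<close>
definition edge :: "(real ^ 3 \<Rightarrow> real ^ 3) \<Rightarrow> bool list \<Rightarrow> real \<Rightarrow> real" where
  "edge f v a = dist (f (pt a (lft v))) (f (pt a (lft v + len (length v))))"

text \<open>
  Let \<open>u\<close> be the left edge of the gap in \<open>v\<close>, and let \<open>L\<close> and \<open>T\<close> be the sizes of the images of
  the gap and of the left child. The points \<open>x j\<close> of the Cantor set approach \<open>u\<close> from the left,
  each at most half as far away as the one before and, for \<open>j \<le> 8 ^ n\<close>, no closer to \<open>u\<close> than the
  gap is wide. Weak quasisymmetry at \<open>u\<close> and at the \<open>x j\<close> makes their images \<open>L / H\<^sup>2\<close>-separated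
  in a ball of radius \<open>H * T\<close>, so packing gives \<open>2 ^ n * L \<le> 4 * H ^ 3 * T\<close>.
\<close>
lemma gap_image_le:
  fixes f :: "real ^ 3 \<Rightarrow> real ^ 3"
  assumes H: "1 \<le> H" and \<rho>: "len (Suc (length v)) < \<rho>"
    and qs: "\<And>y. y \<in> cantor \<Longrightarrow> y \<in> cell v \<Longrightarrow> weak_qs_at f H \<rho> (pt a y)"
  defines "u \<equiv> lft v + len (Suc (length v))"
  shows "dist (f (pt a (lft (True # v)))) (f (pt a u)) \<le> 4 * H ^ 3 / 2 ^ length v * edge f (False # v) a"
proof -
  define n where "n = length v"
  define s where "s = (8::nat) ^ n"
  define x where "x j = lft (replicate j True @ (False # v))" for j
  have x: "x j = u - len (Suc n + j)" for j
    using rgt_replicate_True[of j "False # v"] by (simp add: x_def u_def n_def add.commute)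
  have xK: "x j \<in> cantor" "x j \<in> cell v" for j
    unfolding x_def using lft_in_cantor lft_in_cell[of "(replicate j True @ [False]) @ v"]
      cell_append[of "replicate j True @ [False]" v] by auto
  have uK: "u \<in> cantor" "u \<in> cell v"
    using rgt_in_cantor[of "False # v"] rgt_in_cell[of "False # v"] cell_Cons[of False v]
    by (auto simp: u_def)
  have qsu: "weak_qs_at f H \<rho> (pt a u)" using qs uK by blast
  have qsx: "weak_qs_at f H \<rho> (pt a (x j))" for j using qs xK by blast
  have du: "dist (pt a (x j)) (pt a u) = len (Suc n + j)" for j
    using len_pos[of "Suc n + j"] by (simp add: x)
  have lenj: "len (Suc n + j) < \<rho>" for j
    using \<rho> len_antimono[of "Suc n" "Suc n + j"] by (simp add: n_def)
  define L where "L = dist (f (pt a (lft (True # v)))) (f (pt a u))"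
  define T where "T = edge f (False # v) a"
  have T: "T = dist (f (pt a (x 0))) (f (pt a u))"
    by (simp add: T_def edge_def x_def u_def)
  have gap: "dist (pt a (lft (True # v))) (pt a u) \<le> len (Suc n + s)"
    using gap_le[of n] len_Suc[of n] by (simp add: u_def n_def s_def)
  \<comment> \<open>The far edge of the gap is not farther from \<open>u\<close> than \<open>x j\<close>.\<close>
  have L_le: "L \<le> H * dist (f (pt a (x j))) (f (pt a u))" if "j \<le> s" for j
    unfolding L_def
  proof (rule weak_qs_atD[OF qsu])
    show "dist (pt a (lft (True # v))) (pt a u) \<le> dist (pt a (x j)) (pt a u)"
      using gap len_antimono[of "Suc n + j" "Suc n + s"] that unfolding du by simp
  qed (simp only: du lenj)
  \<comment> \<open>Seen from \<open>x j\<close>, the point \<open>u\<close> is not farther away than \<open>x i\<close>, because distances to \<open>u\<close> at least halve.\<close>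
  have sep: "L / H\<^sup>2 \<le> dist (f (pt a (x i))) (f (pt a (x j)))" if "i < j" "j \<le> s" for i j
  proof -
    have d: "dist (pt a (x i)) (pt a (x j)) = len (Suc n + i) - len (Suc n + j)"
      using len_less[of "Suc n + i" "Suc n + j"] that len_pos[of "Suc n + j"] by (simp add: x)
    have "dist (f (pt a u)) (f (pt a (x j))) \<le> H * dist (f (pt a (x i))) (f (pt a (x j)))"
    proof (rule weak_qs_atD[OF qsx])
      show "dist (pt a u) (pt a (x j)) \<le> dist (pt a (x i)) (pt a (x j))"
        using len_less[of "Suc n + i" "Suc n + j"] that
        unfolding d by (subst dist_commute) (simp only: du, simp)
      show "dist (pt a (x i)) (pt a (x j)) < \<rho>"
        unfolding d using lenj[of i] len_pos[of "Suc n + j"] by linarith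
    qed
    then have "H * dist (f (pt a u)) (f (pt a (x j))) \<le> H * (H * dist (f (pt a (x i))) (f (pt a (x j))))"
      using H by (intro mult_left_mono) auto
    then have "L \<le> H\<^sup>2 * dist (f (pt a (x i))) (f (pt a (x j)))"
      using L_le[OF that(2)] by (simp add: dist_commute power2_eq_square)
    then show ?thesis using H by (simp add: field_simps)
  qed
  have sub: "dist (f (pt a (x j))) (f (pt a u)) \<le> H * T" for j
    unfolding T
  proof (rule weak_qs_atD[OF qsu])
    show "dist (pt a (x j)) (pt a u) \<le> dist (pt a (x 0)) (pt a u)"
      unfolding du by (rule len_antimono) simp
  qed (simp only: du lenj)
  have T0: "0 \<le> T" by (simp add: T)
  have "L \<le> 4 * H ^ 3 / 2 ^ n * T"
  proof (cases "L = 0")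
    case True
    then show ?thesis using T0 H by simp
  next
    case False
    define r where "r = L / (2 * H\<^sup>2)"
    have L0: "0 < L" using False by (simp add: L_def)
    have r0: "0 < r" using L0 H by (simp add: r_def)
    have pk: "real (Suc s) * r ^ 3 \<le> (H * T + r) ^ 3"
      using packing[of "Suc s" r "\<lambda>j. f (pt a (x j))" "f (pt a u)" "H * T"] sep sub r0 T0 H
      by (auto simp: r_def)
    have "1 * 1 \<le> 2 * H\<^sup>2" using H by (intro mult_mono) auto
    then have "r \<le> L" using L0 unfolding r_def by (simp add: divide_le_eq)
    then have rT: "r \<le> H * T" using L_le[of 0] by (simp add: T)
    have "(2 ^ n * r) ^ 3 = real s * r ^ 3"
    proof -
      have "((2::real) ^ n) ^ 3 = (2 ^ 3) ^ n" by (simp only: power_mult[symmetric] mult.commute)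
      then show ?thesis by (simp add: s_def power_mult_distrib)
    qed
    also have "\<dots> \<le> real (Suc s) * r ^ 3"
      using r0 by (intro mult_right_mono) auto
    also have "\<dots> \<le> (H * T + r) ^ 3" by (rule pk)
    also have "\<dots> \<le> (2 * (H * T)) ^ 3"
      using rT r0 T0 H by (intro power_mono) auto
    finally have "2 ^ n * r \<le> 2 * (H * T)"
      using r0 T0 H by (subst (asm) power_mono_iff) auto
    then show ?thesis using H by (simp add: r_def field_simps power2_eq_square power3_eq_cube)
  qed
  then show ?thesis by (simp add: L_def T_def n_def)
qed

lemma edge_le_children:
  fixes f :: "real ^ 3 \<Rightarrow> real ^ 3"
  assumes H: "1 \<le> H" and \<rho>: "len (Suc (length v)) < \<rho>"
    and qs: "\<And>y. y \<in> cantor \<Longrightarrow> y \<in> cell v \<Longrightarrow> weak_qs_at f H \<rho> (pt a y)"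
  shows "edge f v a \<le> (1 + 4 * H ^ 3 / 2 ^ length v) * (edge f (False # v) a + edge f (True # v) a)"
proof -
  let ?u = "lft v + len (Suc (length v))"
  let ?d = "4 * H ^ 3 / 2 ^ length v"
  have d0: "0 \<le> ?d" using H by simp
  have "edge f v a \<le> edge f (False # v) a + dist (f (pt a (lft (True # v)))) (f (pt a ?u)) + edge f (True # v) a"
    unfolding edge_def
    using dist_triangle[of "f (pt a (lft v))" "f (pt a (lft v + len (length v)))" "f (pt a (lft (True # v)))"]
      dist_triangle[of "f (pt a (lft v))" "f (pt a (lft (True # v)))" "f (pt a ?u)"]
    by (simp add: dist_commute)
  also have "\<dots> \<le> edge f (False # v) a + ?d * edge f (False # v) a + edge f (True # v) a"
    using gap_image_le[OF H \<rho> qs] by simp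
  also have "\<dots> \<le> (1 + ?d) * (edge f (False # v) a + edge f (True # v) a)"
    using mult_nonneg_nonneg[OF d0, of "edge f (True # v) a"]
    by (simp add: distrib_left distrib_right edge_def)
  finally show ?thesis .
qed

section \<open>A discrete length-area inequality\<close>

text \<open>
  The mean over the columns \<open>k\<close> generations below \<open>w\<close>, each represented by its left end point. It
  plays the role of the integral over the Cantor set inside the interval \<open>w\<close> with respect to the
  uniform measure.
\<close>
primrec avg :: "nat \<Rightarrow> bool list \<Rightarrow> (real \<Rightarrow> real) \<Rightarrow> real" where
  "avg 0 w \<phi> = \<phi> (lft w)"
| "avg (Suc k) w \<phi> = (avg k (False # w) \<phi> + avg k (True # w) \<phi>) / 2"

lemma avg_mono:
  "(\<And>a. a \<in> cantor \<Longrightarrow> a \<in> cell w \<Longrightarrow> \<phi> a \<le> \<psi> a) \<Longrightarrow> avg k w \<phi> \<le> avg k w \<psi>"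
proof (induction k arbitrary: w)
  case 0
  then show ?case by (simp add: lft_in_cantor lft_in_cell)
next
  case (Suc k)
  have "avg k (b # w) \<phi> \<le> avg k (b # w) \<psi>" for b
    using Suc.prems cell_Cons[of b w] by (intro Suc.IH) auto
  from this[of False] this[of True] show ?case by simp
qed

lemma avg_linear: "avg k w (\<lambda>a. c * (\<phi> a + \<psi> a)) = c * (avg k w \<phi> + avg k w \<psi>)"
  by (induction k arbitrary: w) (auto simp: field_simps)

lemma avg_const [simp]: "avg k w (\<lambda>a. c) = c"
  by (induction k arbitrary: w) auto

text \<open>
  Pairs of words \<open>(w, v)\<close> of equal length stand for squares, and \<open>\<phi> v a\<close> for the length carried by
  the interval \<open>v\<close> in column \<open>a\<close>. Write \<open>A w v\<close> for the mean of \<open>\<phi> v\<close> over the columns in \<open>w\<close>.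
  Splitting both the interval and the columns gives
  \<open>A w v \<le> (1 + \<delta>) * (sum of A over the four children) / 2\<close>, and since the square of half the sum
  of four numbers is at most the sum of their squares,
  \<open>(A w v)\<^sup>2 \<le> (1 + \<delta>)\<^sup>2 * (sum of A\<^sup>2 over the four children)\<close>. Exponent \<open>2\<close> is exactly the one
  at which no factor is lost. Going down the tree until a square of the cover \<open>Q\<close> is met proves the
  claim, the factors \<open>(1 + \<delta>)\<^sup>2\<close> being absorbed in the exponential. \<open>N\<close> is any generation at which
  the cover has been met everywhere.
\<close>
lemma tree_energy:
  fixes \<phi> :: "bool list \<Rightarrow> real \<Rightarrow> real" and g :: "bool list \<times> bool list \<Rightarrow> real"
  assumes fin: "finite Q"
    and small: "\<And>w' v'. (w', v') \<in> Q \<Longrightarrow> length w' = length v' \<and> length v' \<le> N"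
    and pos: "\<And>v a. 0 \<le> \<phi> v a" and \<delta>: "\<And>n. 0 \<le> \<delta> n"
    and weight: "\<And>w' v' a. (w', v') \<in> Q \<Longrightarrow> a \<in> cantor \<Longrightarrow> a \<in> cell w' \<Longrightarrow> \<phi> v' a \<le> g (w', v')"
    and step: "\<And>u a. suffix v u \<Longrightarrow> a \<in> cantor \<Longrightarrow> a \<in> cell w \<Longrightarrow>
        \<phi> u a \<le> (1 + \<delta> (length u)) * (\<phi> (False # u) a + \<phi> (True # u) a)"
    and len: "length w = length v" "length v + k = N"
    and cov: "\<And>x y. x \<in> cantor \<Longrightarrow> x \<in> cell w \<Longrightarrow> y \<in> cantor \<Longrightarrow> y \<in> cell v \<Longrightarrow>
        \<exists>(w', v')\<in>Q. suffix w w' \<and> suffix v v' \<and> x \<in> cell w' \<and> y \<in> cell v'"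
  shows "(avg k w (\<phi> v))\<^sup>2 \<le> exp (2 * (\<Sum>m = length v..<N. \<delta> m)) *
           (\<Sum>q\<in>Q. if suffix w (fst q) \<and> suffix v (snd q) then (g q)\<^sup>2 else 0)"
  using step len cov
proof (induction k arbitrary: w v)
  case (Suc k)
  note step = Suc.prems(1) and len = Suc.prems(2,3) and cov = Suc.prems(4)
  define S where "S w v = (\<Sum>q\<in>Q. if suffix w (fst q) \<and> suffix v (snd q) then (g q)\<^sup>2 else 0)" for w v
  show ?case
  proof (cases "(w, v) \<in> Q")
    case True
    have "0 \<le> avg (Suc k) w (\<phi> v)"
      using avg_mono[of w "\<lambda>a. 0" "\<phi> v"] pos by (simp del: avg.simps)
    moreover have "avg (Suc k) w (\<phi> v) \<le> avg (Suc k) w (\<lambda>a. g (w, v))"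
      by (rule avg_mono) (rule weight[OF True])
    then have "avg (Suc k) w (\<phi> v) \<le> g (w, v)" by (simp del: avg.simps)
    ultimately have "(avg (Suc k) w (\<phi> v))\<^sup>2 \<le> (g (w, v))\<^sup>2" by (rule power_mono[rotated])
    also have "\<dots> \<le> S w v"
      unfolding S_def using member_le_sum[OF True, of "\<lambda>q. if suffix w (fst q) \<and> suffix v (snd q) then (g q)\<^sup>2 else 0"] fin
      by auto
    also have "\<dots> \<le> exp (2 * (\<Sum>m = length v..<N. \<delta> m)) * S w v"
    proof -
      have "0 \<le> S w v" unfolding S_def by (intro sum_nonneg) auto
      moreover have "1 \<le> exp (2 * (\<Sum>m = length v..<N. \<delta> m))"
        using \<delta> by (simp add: sum_nonneg)
      ultimately show ?thesis
        using mult_right_mono[of 1 "exp (2 * (\<Sum>m = length v..<N. \<delta> m))" "S w v"] by simp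
    qed
    finally show ?thesis by (simp only: S_def)
  next
    case False
    define P where "P = exp (2 * (\<Sum>m = Suc (length v)..<N. \<delta> m))"
    define A where "A b c = avg k (b # w) (\<phi> (c # v))" for b c
    define d where "d = 1 + \<delta> (length v)"
    have d0: "0 \<le> d" using \<delta> by (simp add: d_def add_nonneg_nonneg)
    have A0: "0 \<le> A b c" for b c
      using avg_mono[of "b # w" "\<lambda>a. 0" "\<phi> (c # v)"] pos by (simp add: A_def)
    have child: "(A b c)\<^sup>2 \<le> P * S (b # w) (c # v)" for b c
    proof -
      have "(avg k (b # w) (\<phi> (c # v)))\<^sup>2 \<le> exp (2 * (\<Sum>m = length (c # v)..<N. \<delta> m)) *
           (\<Sum>q\<in>Q. if suffix (b # w) (fst q) \<and> suffix (c # v) (snd q) then (g q)\<^sup>2 else 0)"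
      proof (rule Suc.IH)
        show "length (b # w) = length (c # v)" "length (c # v) + k = N" using len by auto
        show "\<phi> u a \<le> (1 + \<delta> (length u)) * (\<phi> (False # u) a + \<phi> (True # u) a)"
          if "suffix (c # v) u" "a \<in> cantor" "a \<in> cell (b # w)" for u a
          using that cell_Cons[of b w] by (intro step) (auto dest: suffix_ConsD)
        \<comment> \<open>As the square itself is not in the cover, the squares of the cover inside it lie in its children.\<close>
        show "\<exists>(w', v')\<in>Q. suffix (b # w) w' \<and> suffix (c # v) v' \<and> x \<in> cell w' \<and> y \<in> cell v'"
          if xy: "x \<in> cantor" "x \<in> cell (b # w)" "y \<in> cantor" "y \<in> cell (c # v)" for x y
        proof -
          obtain w' v' where q: "(w', v') \<in> Q" "suffix w w'" "suffix v v'" "x \<in> cell w'" "y \<in> cell v'"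
            using cov[of x y] xy cell_Cons[of b w] cell_Cons[of c v] by blast
          have "length w' = length v'" using small q by blast
          moreover have "length v < length v'"
          proof (rule ccontr)
            assume "\<not> length v < length v'"
            then have "length v' = length v" using suffix_length_le[OF q(3)] by simp
            then have "v' = v" "w' = w"
              using q len \<open>length w' = length v'\<close> by (auto simp: suffix_def)
            with q False show False by simp
          qed
          ultimately have "suffix (b # w) w'" "suffix (c # v) v'"
            using cell_extends[OF xy(2) q(4)] cell_extends[OF xy(4) q(5)] len by auto
          with q show ?thesis by blast
        qed
      qed
      then show ?thesis by (simp add: A_def P_def S_def)
    qed
    have "avg k (b # w) (\<phi> v) \<le> d * (A b False + A b True)" for b
    proof -
      have "avg k (b # w) (\<phi> v) \<le> avg k (b # w) (\<lambda>a. d * (\<phi> (False # v) a + \<phi> (True # v) a))"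
        unfolding d_def using cell_Cons[of b w] by (intro avg_mono step) auto
      then show ?thesis by (simp add: avg_linear A_def)
    qed
    from this[of False] this[of True]
    have le: "avg (Suc k) w (\<phi> v) \<le> d * ((A False False + A False True + A True False + A True True) / 2)"
      by (simp add: algebra_simps)
    have sq4: "((p + q + r + s) / 2)\<^sup>2 \<le> p\<^sup>2 + q\<^sup>2 + r\<^sup>2 + (s::real)\<^sup>2" for p q r s
    proof -
      have "p\<^sup>2 + q\<^sup>2 + r\<^sup>2 + s\<^sup>2 - ((p + q + r + s) / 2)\<^sup>2 =
        ((p - q)\<^sup>2 + (p - r)\<^sup>2 + (p - s)\<^sup>2 + (q - r)\<^sup>2 + (q - s)\<^sup>2 + (r - s)\<^sup>2) / 4"
        by (simp add: power2_eq_square field_simps)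
      also have "\<dots> \<ge> 0" by simp
      finally show ?thesis by simp
    qed
    have "0 \<le> avg (Suc k) w (\<phi> v)"
      using avg_mono[of w "\<lambda>a. 0" "\<phi> v"] pos by (simp del: avg.simps)
    with le have "(avg (Suc k) w (\<phi> v))\<^sup>2 \<le> (d * ((A False False + A False True + A True False + A True True) / 2))\<^sup>2"
      by (rule power_mono)
    also have "\<dots> \<le> d\<^sup>2 * ((A False False)\<^sup>2 + (A False True)\<^sup>2 + (A True False)\<^sup>2 + (A True True)\<^sup>2)"
      unfolding power_mult_distrib by (intro mult_left_mono sq4) auto
    also have "\<dots> \<le> d\<^sup>2 * (P * S w v)"
    proof (rule mult_left_mono)
      have excl: "\<not> (suffix (False # l) l' \<and> suffix (True # l) l')" for l l' :: "bool list"
        by (auto simp: suffix_def)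
      have "S (False # w) (False # v) + S (False # w) (True # v) + S (True # w) (False # v) + S (True # w) (True # v) \<le> S w v"
        unfolding S_def sum.distrib[symmetric]
      proof (rule sum_mono)
        fix q
        show "(if suffix (False # w) (fst q) \<and> suffix (False # v) (snd q) then (g q)\<^sup>2 else 0) +
              (if suffix (False # w) (fst q) \<and> suffix (True # v) (snd q) then (g q)\<^sup>2 else 0) +
              (if suffix (True # w) (fst q) \<and> suffix (False # v) (snd q) then (g q)\<^sup>2 else 0) +
              (if suffix (True # w) (fst q) \<and> suffix (True # v) (snd q) then (g q)\<^sup>2 else 0)
              \<le> (if suffix w (fst q) \<and> suffix v (snd q) then (g q)\<^sup>2 else 0)"
          using excl[of w "fst q"] excl[of v "snd q"] suffix_ConsD[of _ w "fst q"] suffix_ConsD[of _ v "snd q"]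
          by auto
      qed
      then have "P * (S (False # w) (False # v) + S (False # w) (True # v) + S (True # w) (False # v) + S (True # w) (True # v)) \<le> P * S w v"
        by (intro mult_left_mono) (auto simp: P_def)
      then show "(A False False)\<^sup>2 + (A False True)\<^sup>2 + (A True False)\<^sup>2 + (A True True)\<^sup>2 \<le> P * S w v"
        using child[of False False] child[of False True] child[of True False] child[of True True]
        by (simp add: distrib_left)
    qed simp
    also have "\<dots> \<le> (exp (2 * \<delta> (length v)) * P) * S w v"
    proof -
      have "d\<^sup>2 \<le> (exp (\<delta> (length v)))\<^sup>2"
        using d0 unfolding d_def by (intro power_mono exp_ge_add_one_self) auto
      also have "\<dots> = exp (2 * \<delta> (length v))" by (simp add: exp_double)
      finally have "d\<^sup>2 \<le> exp (2 * \<delta> (length v))" .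
      moreover have "0 \<le> P * S w v"
        unfolding S_def P_def by (intro mult_nonneg_nonneg sum_nonneg) auto
      ultimately show ?thesis by (simp only: mult.assoc) (rule mult_right_mono)
    qed
    also have "exp (2 * \<delta> (length v)) * P = exp (2 * (\<Sum>m = length v..<N. \<delta> m))"
      using len by (simp add: P_def sum.atLeast_Suc_lessThan exp_add[symmetric] distrib_left)
    finally show ?thesis by (simp only: S_def)
  qed
next
  case 0
  note len = 0(2,3) and cov = 0(4)
  obtain w' v' where q: "(w', v') \<in> Q" "suffix w w'" "suffix v v'"
    using cov[of "lft w" "lft v"] lft_in_cantor lft_in_cell by blast
  have "w' = w" "v' = v"
    using q small[OF q(1)] len suffix_length_le[OF q(3)] by (auto simp: suffix_def)
  then have Q: "(w, v) \<in> Q" using q by simp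
  have "(avg 0 w (\<phi> v))\<^sup>2 \<le> (g (w, v))\<^sup>2"
    using weight[OF Q lft_in_cantor lft_in_cell] pos by (auto intro: power_mono)
  also have "\<dots> \<le> (\<Sum>q\<in>Q. if suffix w (fst q) \<and> suffix v (snd q) then (g q)\<^sup>2 else 0)"
    using member_le_sum[OF Q, of "\<lambda>q. if suffix w (fst q) \<and> suffix v (snd q) then (g q)\<^sup>2 else 0"] fin
    by auto
  finally show ?case using len by simp
qed

section \<open>Quasiconformal maps are uniformly weakly quasisymmetric on a portion\<close>

text \<open>
  A maximum principle: the image of an open ball is open, so its points are never the farthest from
  \<open>f x\<close>. It lets a comparison of points on the same sphere control all points inside the sphere.
\<close>
lemma homeo_max_on_sphere:
  fixes f :: "'a::euclidean_space \<Rightarrow> 'a"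
  assumes f: "f \<in> self_homeos" and "dist y x \<le> r"
  obtains y' where "dist y' x = r" "dist (f y) (f x) \<le> dist (f y') (f x)"
proof -
  obtain g where hom: "homeomorphism UNIV UNIV f g" using f by (auto simp: self_homeos_def)
  have r0: "0 \<le> r" using assms(2) zero_le_dist[of y x] by linarith
  have contf: "continuous_on S f" and contg: "continuous_on S g" for S
    using hom by (auto simp: homeomorphism_def intro: continuous_on_subset)
  have gf: "g (f z) = z" and fg: "f (g z) = z" for z using hom by (simp_all add: homeomorphism_def)
  have "continuous_on (cball x r) (\<lambda>z. dist (f z) (f x))"
    by (intro continuous_on_dist contf continuous_on_const)
  then obtain m where m: "m \<in> cball x r" "\<And>z. z \<in> cball x r \<Longrightarrow> dist (f z) (f x) \<le> dist (f m) (f x)"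
    using continuous_attains_sup[of "cball x r" "\<lambda>z. dist (f z) (f x)"] r0 by force
  show ?thesis
  proof (cases "dist m x = r")
    case True
    then show ?thesis using that[of m] m(2)[of y] assms(2) by (simp add: dist_commute)
  next
    case False
    then have "m \<in> ball x r" using m(1) by (simp add: dist_commute)
    moreover have "f ` ball x r = g -` ball x r"
      by (rule set_eqI) (metis fg gf image_iff vimage_eq)
    moreover have "open (g -` ball x r)"
      by (intro open_vimage contg) auto
    ultimately have "open (f ` ball x r)" "f m \<in> f ` ball x r" by auto
    then obtain e where e: "0 < e" "cball (f m) e \<subseteq> f ` ball x r"
      by (meson open_contains_cball)
    define d where "d = f m - f x"
    \<comment> \<open>A point of the image just beyond the alleged farthest one.\<close>
    define p where "p = f m + (e / norm d) *\<^sub>R d"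
    have "d = 0"
    proof (rule ccontr)
      assume d: "d \<noteq> 0"
      have "dist (f m) p = e" using d e by (simp add: p_def dist_norm)
      then obtain z where z: "z \<in> ball x r" "p = f z" using e by auto
      have "p - f x = (1 + e / norm d) *\<^sub>R d" by (simp add: p_def d_def algebra_simps)
      then have "dist p (f x) = norm d + e" using d e by (simp add: dist_norm distrib_right)
      moreover have "dist (f z) (f x) \<le> norm d" using m(2)[of z] z by (simp add: d_def dist_norm)
      ultimately show False using e z by simp
    qed
    then have "dist (f y) (f x) \<le> 0" using m(2)[of y] assms(2) by (simp add: d_def dist_commute)
    moreover obtain y' where "dist x y' = r" using vector_choose_dist[OF r0] by blast
    moreover have "0 \<le> dist (f y') (f x)" by simp
    ultimately show ?thesis using that[of y'] by (simp only: dist_commute)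
  qed
qed

lemma weak_qs_at_from_spheres:
  fixes f :: "'a::euclidean_space \<Rightarrow> 'a"
  assumes f: "f \<in> self_homeos" and "0 \<le> H"
    and sph: "\<And>y z. dist y x = dist z x \<Longrightarrow> dist z x < \<rho> \<Longrightarrow> dist (f y) (f x) \<le> H * dist (f z) (f x)"
  shows "weak_qs_at f H \<rho> x"
  unfolding weak_qs_at_def
proof (intro allI impI)
  fix y z assume yz: "dist y x \<le> dist z x" "dist z x < \<rho>"
  obtain y' where "dist y' x = dist z x" "dist (f y) (f x) \<le> dist (f y') (f x)"
    using homeo_max_on_sphere[OF f yz(1)] by blast
  then show "dist (f y) (f x) \<le> H * dist (f z) (f x)" using sph yz(2) by fastforce
qed

lemma metric_dilatation_lessD:
  fixes f :: "'a::euclidean_space \<Rightarrow> 'a"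
  assumes less: "metric_dilatation f x r < ennreal H" and inj: "inj f"
    and yz: "dist y x = r" "dist z x = r" "0 < r"
  shows "dist (f y) (f x) \<le> H * dist (f z) (f x)"
proof -
  define A where "A = (SUP y\<in>sphere x r. ennreal (dist (f x) (f y)))"
  define B where "B = (INF y\<in>sphere x r. ennreal (dist (f x) (f y)))"
  have y: "y \<in> sphere x r" and z: "z \<in> sphere x r" using yz by (auto simp: dist_commute)
  have AB: "A / B < ennreal H" using less by (simp add: metric_dilatation_def A_def B_def)
  have A: "ennreal (dist (f x) (f y)) \<le> A" unfolding A_def by (rule SUP_upper[OF y])
  have B: "B \<le> ennreal (dist (f x) (f z))" unfolding B_def by (rule INF_lower[OF z])
  have "x \<noteq> y" using yz by auto
  then have "f x \<noteq> f y" using inj by (simp add: inj_eq)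
  then have "0 < ennreal (dist (f x) (f y))" by simp
  then have "0 < A" using A by (rule order_less_le_trans)
  have "B \<noteq> 0"
  proof
    assume "B = 0"
    then have "A / B = top" using \<open>0 < A\<close> by (simp add: ennreal_divide_eq_top_iff)
    then show False using AB by simp
  qed
  moreover have "B < top" using B ennreal_less_top by (rule order_le_less_trans)
  ultimately have "A < ennreal H * B" using AB divide_less_ennreal by blast
  then have "A \<le> ennreal H * ennreal (dist (f x) (f z))"
    using mult_left_mono[OF B, of "ennreal H"] by simp
  with A have "ennreal (dist (f x) (f y)) \<le> ennreal H * ennreal (dist (f x) (f z))"
    by (rule order_trans)
  then have "ennreal (dist (f x) (f y)) \<le> ennreal (H * dist (f x) (f z))"
    by (simp add: ennreal_mult'')
  moreover have "0 < H"
    using AB by (cases "0 < H") (auto simp: ennreal_neg)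
  ultimately show ?thesis by (simp add: dist_commute)
qed

text \<open>
  For fixed \<open>m\<close> the points at which all spheres of radius below \<open>1 / (m + 1)\<close> are distorted by at
  most \<open>H\<close> form a closed set \<open>F m\<close>, and these sets cover the space. Baire's theorem in \<open>E\<close>
  gives one \<open>m\<close> for which \<open>F m\<close> contains a relatively open part of \<open>E\<close>.
\<close>
lemma qc_weak_qs_portion:
  fixes f :: "'a::euclidean_space \<Rightarrow> 'a"
  assumes f: "f \<in> qc_homeos" and E: "closed E" "E \<noteq> {}"
  obtains H \<rho> x0 \<epsilon> where "1 \<le> H" "0 < \<rho>" "x0 \<in> E" "0 < \<epsilon>"
    "\<And>x. x \<in> E \<Longrightarrow> dist x x0 < \<epsilon> \<Longrightarrow> weak_qs_at f H \<rho> x"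
proof -
  have sf: "f \<in> self_homeos" using f by (simp add: qc_homeos_def)
  then obtain g where hom: "homeomorphism UNIV UNIV f g" by (auto simp: self_homeos_def)
  have inj: "inj f" using hom by (metis UNIV_I homeomorphism_def inj_on_def)
  have contf: "continuous_on S f" for S
    using hom by (auto simp: homeomorphism_def intro: continuous_on_subset)
  obtain M where M: "M < \<infinity>" "\<And>x. Limsup (at_right 0) (metric_dilatation f x) \<le> M"
    using f by (auto simp: qc_homeos_def)
  \<comment> \<open>One more than the bound on the upper limit, so that it is eventually respected at each point.\<close>
  define H where "H = enn2real M + 1"
  have H: "1 \<le> H" by (simp add: H_def)
  have MH: "M < ennreal H"
  proof -
    have "M = ennreal (enn2real M)" using M(1) by (simp add: ennreal_enn2real_if)
    also have "\<dots> < ennreal H" by (rule ennreal_lessI) (auto simp: H_def add_nonneg_pos)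
    finally show ?thesis .
  qed
  define Z where "Z m = {(u::'a, v::'a). norm u = norm v \<and> norm v < inverse (Suc m)}" for m :: nat
  define F where "F m = (\<Inter>(u, v)\<in>Z m. {x. dist (f (x + u)) (f x) \<le> H * dist (f (x + v)) (f x)})" for m
  have shift: "continuous_on UNIV (\<lambda>x. f (x + u))" for u
    by (rule continuous_on_compose2[OF contf[of UNIV]]) (auto intro: continuous_intros)
  have "closed {x. dist (f (x + u)) (f x) \<le> H * dist (f (x + v)) (f x)}" for u v
    by (intro closed_Collect_le continuous_on_dist continuous_on_mult continuous_on_const shift contf)
  then have closedF: "closed (F m)" for m
    unfolding F_def by (intro closed_INT ballI) (auto split: prod.splits)
  have cover: "\<exists>m. x \<in> F m" for x
  proof -
    have "Limsup (at_right 0) (metric_dilatation f x) < ennreal H"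
      using M(2)[of x] MH by (rule order_le_less_trans)
    then have "\<forall>\<^sub>F r in at_right 0. metric_dilatation f x r < ennreal H" by (rule Limsup_lessD)
    then obtain b where b: "0 < b" "\<And>r. 0 < r \<Longrightarrow> r < b \<Longrightarrow> metric_dilatation f x r < ennreal H"
      by (auto simp: eventually_at_right_field)
    obtain m where m: "inverse (real (Suc m)) < b" using reals_Archimedean[OF b(1)] by blast
    have "dist (f (x + u)) (f x) \<le> H * dist (f (x + v)) (f x)" if "norm u = norm v" "norm v < inverse (real (Suc m))" for u v
    proof (cases "norm v = 0")
      case False
      then show ?thesis
        using that m by (intro metric_dilatation_lessD[OF b(2)[of "norm v"] inj]) (auto simp: dist_norm)
    qed (use that in auto)
    then show ?thesis unfolding F_def Z_def by (intro exI[of _ m]) auto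
  qed
  have "\<exists>m. \<not> E \<subseteq> closure (E - F m)"
  proof (rule ccontr)
    assume "\<not> ?thesis"
    then have dense: "E \<subseteq> closure (E - F m)" for m by blast
    have "E \<subseteq> closure (\<Inter>(range (\<lambda>m. E - F m)))"
    proof (rule Baire[OF E(1)])
      fix T assume "T \<in> range (\<lambda>m. E - F m)"
      then obtain m where "T = E - F m" by blast
      then show "openin (top_of_set E) T \<and> E \<subseteq> closure T"
        using dense[of m] closedF[of m]
        by (metis Diff_eq open_Compl openin_open_Int)
    qed auto
    moreover have "\<Inter>(range (\<lambda>m. E - F m)) = {}" using cover by blast
    ultimately have "E \<subseteq> closure {}" by (simp only:)
    then show False using E(2) by simp
  qed
  then obtain m x0 where x0: "x0 \<in> E" "x0 \<notin> closure (E - F m)" by blast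
  then obtain \<epsilon> where \<epsilon>: "0 < \<epsilon>" "\<And>x. x \<in> E - F m \<Longrightarrow> \<not> dist x x0 < \<epsilon>"
    by (auto simp: closure_approachable)
  show ?thesis
  proof (rule that[OF H _ x0(1) \<epsilon>(1)])
    show "0 < inverse (real (Suc m))" by simp
    fix x assume "x \<in> E" "dist x x0 < \<epsilon>"
    then have "x \<in> F m" using \<epsilon>(2) by blast
    show "weak_qs_at f H (inverse (real (Suc m))) x"
    proof (rule weak_qs_at_from_spheres[OF sf])
      fix y z assume yz: "dist y x = dist z x" "dist z x < inverse (real (Suc m))"
      then have "(y - x, z - x) \<in> Z m" by (simp add: Z_def dist_norm)
      with \<open>x \<in> F m\<close> have "x \<in> {x'. dist (f (x' + (y - x))) (f x') \<le> H * dist (f (x' + (z - x))) (f x')}"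
        unfolding F_def by blast
      then show "dist (f y) (f x) \<le> H * dist (f z) (f x)" by simp
    qed (use H in auto)
  qed
qed

lemma homeo_inverse_uniform:
  fixes f :: "'a::euclidean_space \<Rightarrow> 'a"
  assumes f: "f \<in> self_homeos" and E: "compact E" and "0 < \<epsilon>"
  obtains \<delta> where "0 < \<delta>" "\<And>x y. x \<in> E \<Longrightarrow> dist (f y) (f x) \<le> \<delta> \<Longrightarrow> dist y x < \<epsilon>"
proof -
  obtain g where hom: "homeomorphism UNIV UNIV f g" using f by (auto simp: self_homeos_def)
  have contf: "continuous_on S f" and contg: "continuous_on S g" for S
    using hom by (auto simp: homeomorphism_def intro: continuous_on_subset)
  have gf: "g (f x) = x" for x using hom by (simp add: homeomorphism_def)
  define S where "S = {z + u | z u. z \<in> f ` E \<and> u \<in> cball 0 1}"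
  have "compact S" unfolding S_def
    by (intro compact_sums compact_continuous_image contf E compact_cball)
  then have "uniformly_continuous_on S g" by (rule compact_uniformly_continuous[OF contg])
  then obtain \<delta> where \<delta>: "0 < \<delta>" "\<And>p q. p \<in> S \<Longrightarrow> q \<in> S \<Longrightarrow> dist q p < \<delta> \<Longrightarrow> dist (g q) (g p) < \<epsilon>"
    using \<open>0 < \<epsilon>\<close> by (auto simp: uniformly_continuous_on_def)
  show ?thesis
  proof (rule that[of "min 1 (\<delta> / 2)"])
    fix x y assume x: "x \<in> E" and d: "dist (f y) (f x) \<le> min 1 (\<delta> / 2)"
    have S: "f x + u \<in> S" if "norm u \<le> 1" for u using x that by (auto simp: S_def)
    have "f y \<in> S" "f x \<in> S"
      using S[of "f y - f x"] S[of 0] d by (simp_all add: dist_norm)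
    then have "dist (g (f y)) (g (f x)) < \<epsilon>"
      using d \<delta> by (intro \<delta>(2)) auto
    then show "dist y x < \<epsilon>" by (simp add: gf)
  qed (use \<delta> in auto)
qed

section \<open>Lower bound for covers of the image\<close>

text \<open>
  The left end points are separated by more than \<open>(1/2) ^ n\<close>, so rounding them to a grid of that
  size is injective.
\<close>
lemma card_words_near:
  assumes "\<beta> \<le> \<alpha> + real m * (1/2) ^ n"
  shows "card {w. length w = n \<and> \<alpha> \<le> lft w \<and> lft w \<le> \<beta>} \<le> Suc m" (is "card ?W \<le> _")
proof -
  define h where "h w = nat \<lfloor>(lft w - \<alpha>) * 2 ^ n\<rfloor>" for w
  have "inj_on h ?W"
  proof (rule inj_onI, rule ccontr)
    fix w w' assume w: "w \<in> ?W" "w' \<in> ?W" "h w = h w'" "w \<noteq> w'"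
    then have "\<lfloor>(lft w - \<alpha>) * 2 ^ n\<rfloor> = \<lfloor>(lft w' - \<alpha>) * 2 ^ n\<rfloor>"
      by (simp add: h_def eq_nat_nat_iff)
    then have "\<bar>(lft w - \<alpha>) * 2 ^ n - (lft w' - \<alpha>) * 2 ^ n\<bar> < 1" by linarith
    moreover have "(lft w - \<alpha>) * 2 ^ n - (lft w' - \<alpha>) * 2 ^ n = (lft w - lft w') * 2 ^ n"
      by (simp add: algebra_simps)
    ultimately have "\<bar>lft w - lft w'\<bar> * 2 ^ n < 1" by (simp add: abs_mult)
    moreover have "(1/2) ^ n < \<bar>lft w - lft w'\<bar>"
      using lft_separated[of w w'] w len_ge[of n] by simp
    ultimately show False by (simp add: power_one_over field_simps)
  qed
  moreover have "h ` ?W \<subseteq> {..m}"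
  proof
    fix j assume "j \<in> h ` ?W"
    then obtain w where w: "w \<in> ?W" "j = h w" by blast
    have "(lft w - \<alpha>) * 2 ^ n \<le> (real m * (1/2) ^ n) * 2 ^ n"
      using w assms by (intro mult_right_mono) auto
    also have "\<dots> = real m" by (simp add: power_one_over)
    finally show "j \<in> {..m}" using w by (simp add: h_def) linarith
  qed
  ultimately have "card ?W \<le> card {..m}" by (intro card_inj_on_le) auto
  then show ?thesis by simp
qed

text \<open>
  The part of the Cantor product in one square of the construction; for empty words it is the whole
  product.
\<close>
definition portion :: "bool list \<Rightarrow> bool list \<Rightarrow> (real ^ 3) set" where
  "portion w v = {pt a b | a b. a \<in> cantor \<inter> cell w \<and> b \<in> cantor \<inter> cell v}"

lemma compact_portion: "compact (portion w v)"
proof -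
  have "portion w v = (\<lambda>p. pt (fst p) (snd p)) ` ((cantor \<inter> cell w) \<times> (cantor \<inter> cell v))"
    by (force simp: portion_def image_iff)
  moreover have "compact \<dots>"
    by (intro compact_continuous_image continuous_intros compact_Times compact_Int_closed compact_cantor)
       (auto simp: cell_def)
  ultimately show ?thesis by simp
qed

definition squares_meeting ::
    "(real ^ 3 \<Rightarrow> real ^ 3) \<Rightarrow> nat \<Rightarrow> real ^ 3 \<Rightarrow> real \<Rightarrow> (bool list \<times> bool list) set" where
  "squares_meeting f n c d =
     {(w, v). length w = n \<and> length v = n \<and> (\<exists>p\<in>portion w v. dist (f p) c < d)}"

text \<open>
  Let \<open>R\<close> be the distance from \<open>x\<close> to the farthest point \<open>y\<close> of the preimage of the ball of
  radius \<open>d\<close> about \<open>f x\<close>. Squares a fixed fraction of \<open>R\<close> in size that meet this preimage are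
  boundedly many. If \<open>p\<close> is a common point of such a square and the preimage, then \<open>x\<close> or \<open>y\<close> is at
  distance at least \<open>R / 2\<close> from \<open>p\<close>, hence not closer to \<open>p\<close> than any point of the square, while
  its image is within \<open>2 * d\<close> of \<open>f p\<close>; weak quasisymmetry at \<open>p\<close> bounds the image of the square.
\<close>
lemma ball_squares:
  fixes f :: "real ^ 3 \<Rightarrow> real ^ 3"
  assumes f: "f \<in> self_homeos" and H: "0 \<le> H" and w0: "length w0 = n0" "length v0 = n0"
    and qs: "\<And>p. p \<in> portion w0 v0 \<Longrightarrow> weak_qs_at f H \<rho> p"
    and x: "x \<in> portion w0 v0" and d: "0 < d"
    and small: "\<And>y. dist (f y) (f x) \<le> d \<Longrightarrow> dist y x < \<rho> / 2 \<and> dist y x < 8 * (1/2) ^ n0"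
  obtains n where "n0 \<le> n" "card (squares_meeting f n (f x) d) \<le> 35\<^sup>2"
    "\<And>w v a. (w, v) \<in> squares_meeting f n (f x) d \<Longrightarrow> suffix w0 w \<Longrightarrow> suffix v0 v \<Longrightarrow> a \<in> cell w \<Longrightarrow>
       edge f v a \<le> 4 * H * d"
proof -
  obtain g where hom: "homeomorphism UNIV UNIV f g" using f by (auto simp: self_homeos_def)
  have contg: "continuous_on S g" for S
    using hom by (auto simp: homeomorphism_def intro: continuous_on_subset)
  have gf: "g (f z) = z" and fg: "f (g z) = z" for z using hom by (simp_all add: homeomorphism_def)
  define C where "C = g ` cball (f x) d"
  have C: "z \<in> C \<longleftrightarrow> dist (f z) (f x) \<le> d" for z
  proof
    assume "dist (f z) (f x) \<le> d"
    then have "f z \<in> cball (f x) d" by (simp add: dist_commute)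
    then show "z \<in> C" unfolding C_def using gf[of z] by (metis imageI)
  qed (auto simp: C_def fg dist_commute)
  have "compact C" unfolding C_def by (intro compact_continuous_image contg compact_cball)
  moreover have "x \<in> C" using d by (simp add: C)
  then have "C \<noteq> {}" by blast
  moreover have "continuous_on C (\<lambda>z. dist z x)"
    by (intro continuous_on_dist continuous_on_id continuous_on_const)
  ultimately have "\<exists>y\<in>C. \<forall>z\<in>C. dist z x \<le> dist y x" by (rule continuous_attains_sup)
  then obtain y where y: "y \<in> C" "\<And>z. z \<in> C \<Longrightarrow> dist z x \<le> dist y x" by blast
  define R where "R = dist y x"
  have R\<rho>: "R < \<rho> / 2" and R0: "R < 8 * (1/2) ^ n0" using small[of y] y(1) by (auto simp: C R_def)
  have "0 < R"
  proof -
    obtain q where q: "dist (f x) q = d" using vector_choose_dist[of d "f x"] d by auto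
    have "g q \<in> C" unfolding C_def using q by auto
    moreover have "g q \<noteq> x" using q d fg[of q] by auto
    ultimately show ?thesis using y(2)[of "g q"] zero_less_dist_iff[of "g q" x] unfolding R_def by linarith
  qed
  \<comment> \<open>Squares of generation \<open>n\<close> have side at most \<open>2 * (1/2) ^ n\<close>, hence \<open>l1\<close>-diameter at most \<open>R / 2\<close>.\<close>
  define n where "n = (LEAST n. (1/2) ^ n \<le> R / 8)"
  have ex: "\<exists>n. (1/2::real) ^ n \<le> R / 8"
    using real_arch_pow_inv[of "R / 8" "1/2"] \<open>0 < R\<close> by (auto intro: less_imp_le)
  have n: "(1/2) ^ n \<le> R / 8" unfolding n_def by (rule LeastI_ex[OF ex])
  have "n0 < n"
  proof (rule ccontr)
    assume "\<not> n0 < n"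
    then have "(1/2::real) ^ n0 \<le> (1/2) ^ n" by (intro power_decreasing) auto
    with n R0 show False by linarith
  qed
  then obtain k where k: "n = Suc k" by (cases n) auto
  then have "\<not> (1/2) ^ k \<le> R / 8" using not_less_Least[of k "\<lambda>n. (1/2) ^ n \<le> R / 8"] by (simp add: n_def)
  then have R16: "R < 16 * (1/2) ^ n" by (simp add: k)
  obtain x1 x2 where x12: "x = pt x1 x2" using x by (auto simp: portion_def)
  show ?thesis
  proof (rule that[of n])
    show "n0 \<le> n" using \<open>n0 < n\<close> by simp
    \<comment> \<open>Left end points of intervals of length at most \<open>2 * (1/2) ^ n\<close> that come within \<open>16 * (1/2) ^ n\<close> of \<open>z\<close>.\<close>
    define W where "W z = {w. length w = n \<and> z - 18 * (1/2) ^ n \<le> lft w \<and> lft w \<le> z + 16 * (1/2) ^ n}" for z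
    have W: "card (W z) \<le> 35" for z
      using card_words_near[of "z + 16 * (1/2) ^ n" "z - 18 * (1/2) ^ n" 34 n] by (simp add: W_def)
    have finW: "finite (W z)" for z
      unfolding W_def by (rule finite_subset[OF _ finite_words[of n]]) auto
    have "squares_meeting f n (f x) d \<subseteq> W x1 \<times> W x2"
    proof
      fix q assume q: "q \<in> squares_meeting f n (f x) d"
      obtain w v where [simp]: "q = (w, v)" by (cases q)
      from q obtain a b where ab: "length w = n" "length v = n" "a \<in> cell w" "b \<in> cell v" "dist (f (pt a b)) (f x) < d"
        by (auto simp: squares_meeting_def portion_def)
      then have "dist (pt a b) x \<le> R" using y(2)[of "pt a b"] by (simp add: C R_def)
      then have "\<bar>a - x1\<bar> \<le> R" "\<bar>b - x2\<bar> \<le> R"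
        using fst_le_dist_pt[of a x1 b x2] snd_le_dist_pt[of b x2 a x1] by (auto simp: x12)
      then show "q \<in> W x1 \<times> W x2"
        using ab R16 len_le[of n] by (auto simp: W_def cell_def abs_le_iff)
    qed
    then have "card (squares_meeting f n (f x) d) \<le> card (W x1 \<times> W x2)"
      by (intro card_mono finite_cartesian_product finW)
    also have "\<dots> \<le> 35 * 35" unfolding card_cartesian_product by (intro mult_mono W) auto
    finally show "card (squares_meeting f n (f x) d) \<le> 35\<^sup>2" by simp
    fix w v a assume q: "(w, v) \<in> squares_meeting f n (f x) d" "suffix w0 w" "suffix v0 v" and a: "a \<in> cell w"
    then obtain a' b' where p: "length w = n" "length v = n" "a' \<in> cantor" "a' \<in> cell w" "b' \<in> cantor" "b' \<in> cell v"
        "dist (f (pt a' b')) (f x) < d"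
      by (auto simp: squares_meeting_def portion_def)
    define p where "p = pt a' b'"
    have sub: "cell w \<subseteq> cell w0" "cell v \<subseteq> cell v0"
      using q cell_append by (auto simp: suffix_def)
    then have "p \<in> portion w0 v0" using p by (auto simp: p_def portion_def)
    then have qsp: "weak_qs_at f H \<rho> p" by (rule qs)
    have "dist y x \<le> dist y p + dist x p" by (rule dist_triangle2)
    then have "R / 2 \<le> dist x p \<or> R / 2 \<le> dist y p" unfolding R_def by linarith
    then obtain z where z: "z = x \<or> z = y" "R / 2 \<le> dist z p" by blast
    have zC: "dist (f z) (f x) \<le> d" using z(1) y(1) d by (auto simp: C)
    have px: "dist p x \<le> R" using y(2)[of p] p by (simp add: C R_def p_def)
    have zx: "dist z x \<le> R" using z(1) \<open>0 < R\<close> by (auto simp: R_def)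
    have "dist z p \<le> dist z x + dist p x" by (rule dist_triangle2)
    then have zp: "dist z p < \<rho>" using zx px R\<rho> by linarith
    have fz: "dist (f z) (f p) \<le> 2 * d"
      using dist_triangle2[of "f z" "f p" "f x"] zC p by (simp add: p_def)
    have near: "dist (f (pt a b)) (f p) \<le> 2 * H * d" if b: "b \<in> cell v" for b
    proof -
      have "dist (pt a b) p \<le> \<bar>a - a'\<bar> + \<bar>b - b'\<bar>" unfolding p_def by (rule dist_pt_le)
      also have "\<dots> \<le> len n + len n"
        using p a b by (intro add_mono) (auto simp: cell_def abs_le_iff)
      also have "\<dots> \<le> R / 2" using n len_le[of n] by linarith
      finally have "dist (f (pt a b)) (f p) \<le> H * dist (f z) (f p)"
        using z zp by (intro weak_qs_atD[OF qsp]) auto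
      also have "\<dots> \<le> H * (2 * d)" by (rule mult_left_mono[OF fz H])
      finally show ?thesis by simp
    qed
    show "edge f v a \<le> 4 * H * d"
      unfolding edge_def
      using near[OF lft_in_cell[of v]] near[OF rgt_in_cell[of v]]
        dist_triangle2[of "f (pt a (lft v))" "f (pt a (lft v + len (length v)))" "f p"] by simp
  qed
qed

text \<open>
  Replace each ball of the cover by the squares from \<open>ball_squares\<close> and apply \<open>tree_energy\<close> to the
  lengths \<open>edge f\<close>. The starting value is at least \<open>c0\<^sup>2\<close>, where \<open>c0\<close> is the least distance between
  the images of the ends of a column, which is positive by compactness and injectivity. The
  conclusion is the positivity of two-dimensional Hausdorff measure, for covers by finitely many
  balls.
\<close>
lemma ball_cover_energy:
  fixes f :: "real ^ 3 \<Rightarrow> real ^ 3"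
  assumes f: "f \<in> self_homeos" and H: "1 \<le> H" and \<rho>: "len n0 < \<rho>"
    and w0: "length w0 = n0" "length v0 = n0"
    and qs: "\<And>p. p \<in> portion w0 v0 \<Longrightarrow> weak_qs_at f H \<rho> p"
  obtains c \<delta> where "0 < c" "0 < \<delta>"
    "\<forall>(F :: nat set) x d. finite F \<longrightarrow> (\<forall>i\<in>F. x i \<in> portion w0 v0 \<and> 0 < d i \<and> d i \<le> \<delta>) \<longrightarrow>
       f ` portion w0 v0 \<subseteq> (\<Union>i\<in>F. ball (f (x i)) (d i)) \<longrightarrow> c \<le> (\<Sum>i\<in>F. (d i)\<^sup>2)"
proof -
  obtain g where hom: "homeomorphism UNIV UNIV f g" using f by (auto simp: self_homeos_def)
  have contf: "continuous_on S f" for S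
    using hom by (auto simp: homeomorphism_def intro: continuous_on_subset)
  have inj: "f x = f y \<longleftrightarrow> x = y" for x y using hom by (metis UNIV_I homeomorphism_def)
  have \<rho>0: "0 < \<rho>" using \<rho> len_pos[of n0] by linarith
  define K where "K = exp (16 * H ^ 3) * (35\<^sup>2 * (4 * H)\<^sup>2)"
  have K0: "0 < K" using H by (simp add: K_def)
  have "continuous_on (cell w0) (edge f v0)"
    unfolding edge_def by (intro continuous_intros continuous_on_compose2[OF contf[of UNIV]]) auto
  moreover have "compact (cell w0)" "cell w0 \<noteq> {}" using lft_in_cell[of w0] by (auto simp: cell_def)
  ultimately obtain a0 where a0: "a0 \<in> cell w0" "\<And>a. a \<in> cell w0 \<Longrightarrow> edge f v0 a0 \<le> edge f v0 a"
    by (metis continuous_attains_inf)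
  define c0 where "c0 = edge f v0 a0"
  have "pt a0 (lft v0) \<noteq> pt a0 (lft v0 + len (length v0))"
    using len_pos[of "length v0"] dist_pt_same[of a0 "lft v0" "lft v0 + len (length v0)"] by force
  then have c0: "0 < c0" by (simp add: c0_def edge_def inj)
  have "0 < min (\<rho> / 2) (8 * (1/2) ^ n0)" using \<rho>0 by simp
  then obtain \<delta> where \<delta>: "0 < \<delta>" "\<And>x y. x \<in> portion w0 v0 \<Longrightarrow> dist (f y) (f x) \<le> \<delta> \<Longrightarrow> dist y x < min (\<rho> / 2) (8 * (1/2) ^ n0)"
    using homeo_inverse_uniform[OF f compact_portion] by blast
  show ?thesis
  proof (rule that[of "c0\<^sup>2 / K" \<delta>], goal_cases)
    case 3
    show ?case
    proof (intro allI impI)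
      fix F :: "nat set" and x d
      assume F: "finite F" and xd: "\<forall>i\<in>F. x i \<in> portion w0 v0 \<and> 0 < d i \<and> d i \<le> \<delta>"
        and cover: "f ` portion w0 v0 \<subseteq> (\<Union>i\<in>F. ball (f (x i)) (d i))"
      have "\<exists>n. n0 \<le> n \<and> card (squares_meeting f n (f (x i)) (d i)) \<le> 35\<^sup>2 \<and>
          (\<forall>w v a. (w, v) \<in> squares_meeting f n (f (x i)) (d i) \<longrightarrow> suffix w0 w \<longrightarrow> suffix v0 v \<longrightarrow> a \<in> cell w \<longrightarrow>
            edge f v a \<le> 4 * H * d i)" if "i \<in> F" for i
      proof (rule ball_squares[OF f _ w0 qs])
        show "x i \<in> portion w0 v0" "0 < d i" using xd that by auto
        show "dist y (x i) < \<rho> / 2 \<and> dist y (x i) < 8 * (1/2) ^ n0" if "dist (f y) (f (x i)) \<le> d i" for y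
          using \<delta>(2)[of "x i" y] xd \<open>i \<in> F\<close> that by auto
      qed (use H in auto)
      then obtain n where n: "\<And>i. i \<in> F \<Longrightarrow> n0 \<le> n i"
          "\<And>i. i \<in> F \<Longrightarrow> card (squares_meeting f (n i) (f (x i)) (d i)) \<le> 35\<^sup>2"
          "\<And>i w v a. i \<in> F \<Longrightarrow> (w, v) \<in> squares_meeting f (n i) (f (x i)) (d i) \<Longrightarrow> suffix w0 w \<Longrightarrow> suffix v0 v \<Longrightarrow>
             a \<in> cell w \<Longrightarrow> edge f v a \<le> 4 * H * d i"
        by metis
      define S where "S i = {q \<in> squares_meeting f (n i) (f (x i)) (d i). suffix w0 (fst q) \<and> suffix v0 (snd q)}" for i
      have finsq: "finite (squares_meeting f m c r)" for m c r
        by (rule finite_subset[OF _ finite_cartesian_product[OF finite_words[of m] finite_words[of m]]])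
           (auto simp: squares_meeting_def)
      have finS: "finite (S i)" for i unfolding S_def using finsq by simp
      have cardS: "real (card (S i)) \<le> 35\<^sup>2" if "i \<in> F" for i
      proof -
        have "card (S i) \<le> card (squares_meeting f (n i) (f (x i)) (d i))"
          unfolding S_def by (intro card_mono finsq) auto
        then have "card (S i) \<le> 35\<^sup>2" using n(2)[OF that] by linarith
        then show ?thesis by (metis of_nat_le_iff of_nat_numeral of_nat_power)
      qed
      define Q where "Q = (\<Union>i\<in>F. S i)"
      \<comment> \<open>A square may come from several balls; the sum dominates the contribution of each of them.\<close>
      define W where "W q = (\<Sum>i\<in>F. if q \<in> S i then (4 * H * d i)\<^sup>2 else 0)" for q
      define N where "N = n0 + (\<Sum>i\<in>F. n i)"
      have W0: "0 \<le> W q" for q unfolding W_def by (intro sum_nonneg) auto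
      have nN: "n i \<le> N" if "i \<in> F" for i
        using member_le_sum[of i F n] F that by (simp add: N_def)
      define \<Delta> where "\<Delta> m = 4 * H ^ 3 / 2 ^ m" for m :: nat
      have "(avg (N - n0) w0 (edge f v0))\<^sup>2 \<le> exp (2 * (\<Sum>m = length v0..<N. \<Delta> m)) *
             (\<Sum>q\<in>Q. if suffix w0 (fst q) \<and> suffix v0 (snd q) then (sqrt (W q))\<^sup>2 else 0)"
      proof (rule tree_energy)
        show "finite Q" unfolding Q_def using F finS by blast
        show "length w0 = length v0" "length v0 + (N - n0) = N" using w0 by (auto simp: N_def)
        show "length w' = length v' \<and> length v' \<le> N" if "(w', v') \<in> Q" for w' v'
          using that nN by (auto simp: Q_def S_def squares_meeting_def)
        show "0 \<le> edge f v a" for v a by (simp add: edge_def)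
        show "0 \<le> \<Delta> n" for n using H by (simp add: \<Delta>_def)
        show "edge f v' a \<le> sqrt (W (w', v'))" if q: "(w', v') \<in> Q" and a: "a \<in> cell w'" for w' v' a
        proof -
          obtain i where i: "i \<in> F" "(w', v') \<in> S i" using q by (auto simp: Q_def)
          have "edge f v' a \<le> 4 * H * d i" using i n(3) a by (auto simp: S_def)
          moreover have "(4 * H * d i)\<^sup>2 \<le> W (w', v')"
            unfolding W_def using member_le_sum[OF i(1), of "\<lambda>i. if (w', v') \<in> S i then (4 * H * d i)\<^sup>2 else 0"] F i
            by auto
          ultimately show ?thesis by (meson order_trans real_le_rsqrt)
        qed
        show "edge f u a \<le> (1 + \<Delta> (length u)) * (edge f (False # u) a + edge f (True # u) a)"
          if u: "suffix v0 u" and a: "a \<in> cantor" "a \<in> cell w0" for u a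
          unfolding \<Delta>_def
        proof (rule edge_le_children[OF H])
          show "len (Suc (length u)) < \<rho>"
            using \<rho> len_antimono[of n0 "Suc (length u)"] suffix_length_le[OF u] w0 by auto
          show "weak_qs_at f H \<rho> (pt a y)" if "y \<in> cantor" "y \<in> cell u" for y
          proof (rule qs)
            have "cell u \<subseteq> cell v0" using u cell_append by (auto simp: suffix_def)
            then show "pt a y \<in> portion w0 v0" using a that by (auto simp: portion_def)
          qed
        qed
        fix a b assume ab: "a \<in> cantor" "a \<in> cell w0" "b \<in> cantor" "b \<in> cell v0"
        then have "pt a b \<in> portion w0 v0" by (auto simp: portion_def)
        then have "f (pt a b) \<in> (\<Union>i\<in>F. ball (f (x i)) (d i))" using cover by blast
        then obtain i where i: "i \<in> F" "dist (f (pt a b)) (f (x i)) < d i" by (auto simp: dist_commute)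
        obtain w v where w: "length w = n i" "a \<in> cell w" and v: "length v = n i" "b \<in> cell v"
          using ab(1,3) unfolding cantor_def by blast
        have "suffix w0 w" "suffix v0 v"
          using cell_extends[of a w0 w] cell_extends[of b v0 v] ab w v w0 n(1)[OF i(1)] by auto
        moreover have "(w, v) \<in> squares_meeting f (n i) (f (x i)) (d i)"
          using w v ab i by (auto simp: squares_meeting_def portion_def)
        ultimately show "\<exists>(w', v')\<in>Q. suffix w0 w' \<and> suffix v0 v' \<and> a \<in> cell w' \<and> b \<in> cell v'"
          using w v i by (auto simp: Q_def S_def intro!: bexI[of _ "(w, v)"])
      qed
      also have "(\<Sum>q\<in>Q. if suffix w0 (fst q) \<and> suffix v0 (snd q) then (sqrt (W q))\<^sup>2 else 0) \<le> (\<Sum>q\<in>Q. W q)"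
        using W0 by (intro sum_mono) auto
      also have "(\<Sum>q\<in>Q. W q) = (\<Sum>i\<in>F. \<Sum>q\<in>Q. if q \<in> S i then (4 * H * d i)\<^sup>2 else 0)"
        unfolding W_def by (rule sum.swap)
      also have "\<dots> = (\<Sum>i\<in>F. real (card (S i)) * (4 * H * d i)\<^sup>2)"
      proof (rule sum.cong[OF refl])
        fix i assume "i \<in> F"
        then have "Q \<inter> S i = S i" by (auto simp: Q_def)
        moreover have "finite Q" unfolding Q_def using F finS by blast
        ultimately show "(\<Sum>q\<in>Q. if q \<in> S i then (4 * H * d i)\<^sup>2 else 0) = real (card (S i)) * (4 * H * d i)\<^sup>2"
          by (simp add: sum.inter_restrict[symmetric])
      qed
      also have "\<dots> \<le> (\<Sum>i\<in>F. 35\<^sup>2 * (4 * H * d i)\<^sup>2)"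
        by (intro sum_mono mult_right_mono cardS) auto
      also have "\<dots> = 35\<^sup>2 * (4 * H)\<^sup>2 * (\<Sum>i\<in>F. (d i)\<^sup>2)"
        by (simp add: sum_distrib_left power_mult_distrib mult.assoc)
      also have "exp (2 * (\<Sum>m = length v0..<N. \<Delta> m)) \<le> exp (16 * H ^ 3)"
      proof -
        have "(\<Sum>m = length v0..<N. (1/2::real) ^ m) \<le> (\<Sum>m<N. (1/2) ^ m)"
          by (intro sum_mono2) auto
        also have "\<dots> \<le> 2" by (simp add: sum_gp_strict)
        finally have "4 * H ^ 3 * (\<Sum>m = length v0..<N. (1/2::real) ^ m) \<le> 4 * H ^ 3 * 2"
          using H by (intro mult_left_mono) auto
        moreover have "(\<Sum>m = length v0..<N. \<Delta> m) = 4 * H ^ 3 * (\<Sum>m = length v0..<N. (1/2::real) ^ m)"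
          by (simp add: \<Delta>_def sum_distrib_left power_one_over)
        ultimately show ?thesis by simp
      qed
      finally have le: "(avg (N - n0) w0 (edge f v0))\<^sup>2 \<le> K * (\<Sum>i\<in>F. (d i)\<^sup>2)"
        by (simp add: K_def mult_left_mono mult_right_mono sum_nonneg mult.assoc)
      have "avg (N - n0) w0 (\<lambda>a. c0) \<le> avg (N - n0) w0 (edge f v0)"
        by (rule avg_mono) (simp add: c0_def a0)
      then have "c0\<^sup>2 \<le> (avg (N - n0) w0 (edge f v0))\<^sup>2"
        using c0 by (intro power_mono) auto
      then show "c0\<^sup>2 / K \<le> (\<Sum>i\<in>F. (d i)\<^sup>2)"
        using le K0 by (simp add: divide_le_eq mult.commute)
    qed
  qed (use c0 K0 \<delta> in auto)
qed

text \<open>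
  A cover by arbitrary sets is enlarged to a cover by open balls of positive radius centred in the
  image, by adding \<open>\<eta> * (1/2) ^ i\<close> to the \<open>i\<close>-th diameter; compactness leaves finitely many of them.
  Here \<open>\<eta>\<close> is so small that the added terms account for at most half of the energy.
\<close>
lemma hausdorff_premeasure_portion_pos:
  fixes f :: "real ^ 3 \<Rightarrow> real ^ 3"
  assumes f: "f \<in> self_homeos" and H: "1 \<le> H" and \<rho>: "len n0 < \<rho>"
    and w0: "length w0 = n0" "length v0 = n0"
    and qs: "\<And>p. p \<in> portion w0 v0 \<Longrightarrow> weak_qs_at f H \<rho> p"
  obtains \<delta> where "0 < \<delta>" "\<delta> \<le> 1" "0 < hausdorff_premeasure 2 \<delta> (f ` portion w0 v0)"
proof -
  obtain g where hom: "homeomorphism UNIV UNIV f g" using f by (auto simp: self_homeos_def)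
  have contf: "continuous_on S f" for S
    using hom by (auto simp: homeomorphism_def intro: continuous_on_subset)
  let ?P = "portion w0 v0"
  obtain c \<delta> where c: "0 < c" and \<delta>: "0 < \<delta>"
    and energy: "\<forall>(F :: nat set) x d. finite F \<longrightarrow> (\<forall>i\<in>F. x i \<in> ?P \<and> 0 < d i \<and> d i \<le> \<delta>) \<longrightarrow>
       f ` ?P \<subseteq> (\<Union>i\<in>F. ball (f (x i)) (d i)) \<longrightarrow> c \<le> (\<Sum>i\<in>F. (d i)\<^sup>2)"
    by (rule ball_cover_energy[OF f H \<rho> w0 qs])
  define \<delta>' where "\<delta>' = min 1 (\<delta> / 2)"
  have "ennreal (c / 4) \<le> hausdorff_premeasure 2 \<delta>' (f ` ?P)"
    unfolding hausdorff_premeasure_def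
  proof (rule INF_greatest)
    fix U assume "U \<in> delta_covers \<delta>' (f ` ?P)"
    then have cov: "f ` ?P \<subseteq> (\<Union>i. U i)" and bd: "\<And>i. bounded (U i)" and dm: "\<And>i. diameter (U i) \<le> \<delta>'"
      by (auto simp: delta_covers_def)
    define \<eta> where "\<eta> = min (\<delta> / 2) (sqrt (c / 8))"
    have \<eta>: "0 < \<eta>" "\<eta> \<le> \<delta> / 2" using c \<delta> by (auto simp: \<eta>_def)
    have \<eta>2: "\<eta>\<^sup>2 \<le> c / 8"
    proof -
      have "\<eta>\<^sup>2 \<le> (sqrt (c / 8))\<^sup>2" using \<eta> by (intro power_mono) (auto simp: \<eta>_def)
      then show ?thesis using c by simp
    qed
    define I where "I = {i. U i \<inter> f ` ?P \<noteq> {}}"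
    have "\<forall>i\<in>I. \<exists>p. p \<in> ?P \<and> f p \<in> U i" by (auto simp: I_def)
    then obtain x where x: "\<And>i. i \<in> I \<Longrightarrow> x i \<in> ?P" "\<And>i. i \<in> I \<Longrightarrow> f (x i) \<in> U i" by metis
    define d where "d i = diameter (U i) + \<eta> * (1/2) ^ i" for i
    have dia0: "0 \<le> diameter (U i)" for i using bd by (rule diameter_ge_0)
    have d0: "0 < d i" for i using \<eta> dia0[of i] by (simp add: d_def add_nonneg_pos)
    have d\<delta>: "d i \<le> \<delta>" for i
    proof -
      have "\<eta> * (1/2) ^ i \<le> \<eta> * 1" using \<eta> by (intro mult_left_mono power_le_one) auto
      moreover have "diameter (U i) \<le> \<delta> / 2" using dm[of i] by (simp add: \<delta>'_def)
      ultimately show ?thesis using \<eta> unfolding d_def by linarith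
    qed
    have "f ` ?P \<subseteq> (\<Union>i\<in>I. ball (f (x i)) (d i))"
    proof
      fix z assume z: "z \<in> f ` ?P"
      then obtain i where i: "z \<in> U i" using cov by blast
      then have "i \<in> I" using z by (auto simp: I_def)
      have "dist (f (x i)) z \<le> diameter (U i)"
        by (rule diameter_bounded_bound[OF bd x(2)[OF \<open>i \<in> I\<close>] i])
      moreover have "0 < \<eta> * (1/2) ^ i" using \<eta> by simp
      ultimately have "dist (f (x i)) z < d i" unfolding d_def by linarith
      with \<open>i \<in> I\<close> show "z \<in> (\<Union>i\<in>I. ball (f (x i)) (d i))" by auto
    qed
    moreover have "compact (f ` ?P)" by (intro compact_continuous_image contf compact_portion)
    ultimately obtain F where F: "F \<subseteq> I" "finite F" "f ` ?P \<subseteq> (\<Union>i\<in>F. ball (f (x i)) (d i))"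
      by (meson compactE_image open_ball)
    have "c \<le> (\<Sum>i\<in>F. (d i)\<^sup>2)"
      using F x d0 d\<delta> by (intro energy[rule_format, of F x]) auto
    also have "\<dots> \<le> (\<Sum>i\<in>F. 2 * (diameter (U i))\<^sup>2 + 2 * \<eta>\<^sup>2 * (1/2) ^ i)"
    proof (rule sum_mono)
      fix i
      have "(d i)\<^sup>2 + (diameter (U i) - \<eta> * (1/2) ^ i)\<^sup>2 = 2 * (diameter (U i))\<^sup>2 + 2 * (\<eta> * (1/2) ^ i)\<^sup>2"
        by (simp add: d_def power2_eq_square algebra_simps)
      moreover have "(\<eta> * (1/2) ^ i)\<^sup>2 \<le> \<eta>\<^sup>2 * (1/2) ^ i"
      proof -
        have "((1/2::real) ^ i)\<^sup>2 \<le> (1/2) ^ i"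
          unfolding power2_eq_square by (intro mult_left_le_one_le power_le_one) auto
        then show ?thesis by (simp add: power_mult_distrib mult_left_mono)
      qed
      moreover have "0 \<le> (diameter (U i) - \<eta> * (1/2) ^ i)\<^sup>2" by simp
      ultimately show "(d i)\<^sup>2 \<le> 2 * (diameter (U i))\<^sup>2 + 2 * \<eta>\<^sup>2 * (1/2) ^ i" by linarith
    qed
    also have "\<dots> = 2 * (\<Sum>i\<in>F. (diameter (U i))\<^sup>2) + 2 * \<eta>\<^sup>2 * (\<Sum>i\<in>F. (1/2) ^ i)"
      by (simp add: sum.distrib sum_distrib_left)
    also have "\<dots> \<le> 2 * (\<Sum>i\<in>F. (diameter (U i))\<^sup>2) + 2 * \<eta>\<^sup>2 * 2"
    proof -
      have "(\<Sum>i\<in>F. (1/2::real) ^ i) \<le> (\<Sum>i. (1/2) ^ i)"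
        by (intro sum_le_suminf F) auto
      also have "\<dots> = 2" by (simp add: suminf_geometric)
      finally show ?thesis by (intro add_left_mono mult_left_mono) auto
    qed
    finally have "c / 4 \<le> (\<Sum>i\<in>F. (diameter (U i))\<^sup>2)" using \<eta>2 by simp
    then have "ennreal (c / 4) \<le> ennreal (\<Sum>i\<in>F. (diameter (U i))\<^sup>2)" by (rule ennreal_leI)
    also have "\<dots> = (\<Sum>i\<in>F. ennreal ((diameter (U i))\<^sup>2))" by simp
    also have "\<dots> = (\<Sum>i\<in>F. diam_pow 2 (U i))"
    proof (rule sum.cong[OF refl])
      fix i assume "i \<in> F"
      then have "U i \<noteq> {}" using F x by blast
      then show "ennreal ((diameter (U i))\<^sup>2) = diam_pow 2 (U i)"
        using dia0[of i] by (simp add: diam_pow_def powr_numeral)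
    qed
    also have "\<dots> \<le> (\<Sum>i. diam_pow 2 (U i))" by (rule sum_le_suminf) (auto simp: F)
    finally show "ennreal (c / 4) \<le> (\<Sum>i. diam_pow 2 (U i))" .
  qed
  then have "0 < hausdorff_premeasure 2 \<delta>' (f ` ?P)"
    using c by (metis ennreal_less_zero_iff divide_pos_pos order_less_le_trans zero_less_numeral)
  then show ?thesis using that[of \<delta>'] \<delta> by (simp add: \<delta>'_def)
qed

section \<open>Bounds for the Hausdorff dimension\<close>

lemma hausdorff_outer_measure_eq_0I:
  fixes S :: "'a::metric_space set"
  assumes s: "0 < s"
    and cov: "\<And>n. \<exists>\<U>. finite \<U> \<and> card \<U> \<le> N n \<and> S \<subseteq> \<Union>\<U> \<and> (\<forall>V\<in>\<U>. bounded V \<and> diameter V \<le> r n)"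
    and r: "r \<longlonglongrightarrow> 0" and lim: "(\<lambda>n. real (N n) * r n powr s) \<longlonglongrightarrow> 0"
  shows "hausdorff_outer_measure s S = 0"
proof -
  have "hausdorff_premeasure s \<delta> S \<le> 0" if \<delta>: "0 < \<delta>" for \<delta>
  proof (rule ennreal_le_epsilon)
    fix e :: real assume e: "0 < e"
    have "\<forall>\<^sub>F n in sequentially. r n < \<delta>" using r \<delta> by (rule order_tendstoD(2))
    moreover have "\<forall>\<^sub>F n in sequentially. real (N n) * r n powr s < e" using lim e by (rule order_tendstoD(2))
    ultimately have "\<forall>\<^sub>F n in sequentially. r n < \<delta> \<and> real (N n) * r n powr s < e" by (rule eventually_conj)
    then obtain n where n: "r n < \<delta>" "real (N n) * r n powr s < e"
      by (auto simp: eventually_sequentially)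
    obtain \<U> where \<U>: "finite \<U>" "card \<U> \<le> N n" "S \<subseteq> \<Union>\<U>" "\<And>V. V \<in> \<U> \<Longrightarrow> bounded V \<and> diameter V \<le> r n"
      using cov[of n] by blast
    obtain h where h: "bij_betw h {0..<card \<U>} \<U>" using ex_bij_betw_nat_finite[OF \<U>(1)] by blast
    define U where "U i = (if i < card \<U> then h i else {})" for i
    have U\<U>: "U i \<in> \<U>" if "i < card \<U>" for i
      using h that by (auto simp: U_def bij_betw_def)
    have bd: "bounded (U i) \<and> diameter (U i) \<le> \<delta>" for i
    proof (cases "i < card \<U>")
      case True
      then show ?thesis using \<U>(4)[OF U\<U>[OF True]] n by auto
    qed (use \<delta> in \<open>simp add: U_def diameter_def\<close>)
    have "\<Union>\<U> \<subseteq> (\<Union>i. U i)"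
    proof
      fix z assume "z \<in> \<Union>\<U>"
      then obtain V where V: "V \<in> \<U>" "z \<in> V" by blast
      then have "V \<in> h ` {0..<card \<U>}" using h by (simp add: bij_betw_def)
      then obtain i where "i < card \<U>" "V = h i" by auto
      then show "z \<in> (\<Union>i. U i)" using V by (auto simp: U_def intro!: exI[of _ i])
    qed
    then have "U \<in> delta_covers \<delta> S" using \<U>(3) bd by (auto simp: delta_covers_def)
    then have "hausdorff_premeasure s \<delta> S \<le> (\<Sum>i. diam_pow s (U i))"
      unfolding hausdorff_premeasure_def by (rule INF_lower)
    also have "\<dots> = (\<Sum>i<card \<U>. diam_pow s (U i))"
      by (intro suminf_finite) (auto simp: U_def diam_pow_def)
    also have "\<dots> \<le> (\<Sum>i<card \<U>. ennreal (r n powr s))"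
    proof (rule sum_mono)
      fix i assume "i \<in> {..<card \<U>}"
      then have "bounded (U i)" "diameter (U i) \<le> r n" using \<U>(4)[OF U\<U>] by auto
      then have "diameter (U i) powr s \<le> r n powr s"
        using s diameter_ge_0 by (intro powr_mono2) auto
      then show "diam_pow s (U i) \<le> ennreal (r n powr s)"
        using s by (auto simp: diam_pow_def intro: ennreal_leI)
    qed
    also have "\<dots> = ennreal (real (card \<U>) * r n powr s)"
      by (simp add: ennreal_mult ennreal_of_nat_eq_real_of_nat)
    also have "\<dots> \<le> ennreal e"
    proof (rule ennreal_leI)
      have "real (card \<U>) * r n powr s \<le> real (N n) * r n powr s"
        using \<U>(2) by (intro mult_right_mono) auto
      then show "real (card \<U>) * r n powr s \<le> e" using n by linarith
    qed
    finally show "hausdorff_premeasure s \<delta> S \<le> 0 + ennreal e" by simp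
  qed
  then show ?thesis unfolding hausdorff_outer_measure_def by (simp add: SUP_eq_const)
qed

lemma hausdorff_dim_leI:
  assumes t: "0 \<le> t" and zero: "\<And>s. t < s \<Longrightarrow> hausdorff_outer_measure s S = 0"
  shows "hausdorff_dim S \<le> ennreal t"
proof (rule ennreal_le_epsilon)
  fix e :: real assume e: "0 < e"
  have "hausdorff_dim S \<le> ennreal (t + e)"
    unfolding hausdorff_dim_def using t e zero[of "t + e"] by (intro INF_lower) auto
  then show "hausdorff_dim S \<le> ennreal t + ennreal e" using t e by (simp add: ennreal_plus)
qed

lemma diam_pow_antimono:
  assumes "bounded U" "diameter U \<le> 1" "0 \<le> s" "s \<le> t"
  shows "diam_pow t U \<le> diam_pow s U"
proof (cases "U = {}")
  case False
  have d: "0 \<le> diameter U" by (rule diameter_ge_0) fact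
  have "diameter U powr t \<le> diameter U powr s" using assms d by (intro powr_mono') auto
  moreover have "diameter U powr t \<le> 1" using assms d by (intro powr_le1) auto
  ultimately show ?thesis
    using assms by (auto simp: diam_pow_def intro: ennreal_leI)
qed (simp add: diam_pow_def)

text \<open>
  For sets of diameter at most \<open>1\<close> a smaller exponent gives a larger sum, so a positive premeasure
  in dimension \<open>t\<close> at such a scale excludes measure zero in every dimension below \<open>t\<close>.
\<close>
lemma hausdorff_dim_geI:
  assumes \<delta>: "0 < \<delta>" "\<delta> \<le> 1" and pos: "0 < hausdorff_premeasure t \<delta> T" and sub: "T \<subseteq> S"
  shows "ennreal t \<le> hausdorff_dim S"
  unfolding hausdorff_dim_def
proof (rule INF_greatest)
  fix s assume "s \<in> {s. 0 \<le> s \<and> hausdorff_outer_measure s S = 0}"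
  then have s: "0 \<le> s" "hausdorff_outer_measure s S = 0" by auto
  have "t \<le> s"
  proof (rule ccontr)
    assume "\<not> t \<le> s"
    have "hausdorff_premeasure t \<delta> T \<le> hausdorff_premeasure s \<delta> S"
      unfolding hausdorff_premeasure_def
    proof (rule INF_mono)
      fix U assume U: "U \<in> delta_covers \<delta> S"
      have "(\<Sum>i. diam_pow t (U i)) \<le> (\<Sum>i. diam_pow s (U i))"
        using U \<open>\<not> t \<le> s\<close> s \<delta>
        by (intro suminf_le diam_pow_antimono) (auto simp: delta_covers_def intro: order_trans)
      moreover have "U \<in> delta_covers \<delta> T" using U sub by (auto simp: delta_covers_def)
      ultimately show "\<exists>V\<in>delta_covers \<delta> T. (\<Sum>i. diam_pow t (V i)) \<le> (\<Sum>i. diam_pow s (U i))" by blast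
    qed
    also have "\<dots> \<le> hausdorff_outer_measure s S"
      unfolding hausdorff_outer_measure_def using \<delta> by (intro SUP_upper) auto
    finally show False using pos s by simp
  qed
  then show "ennreal t \<le> ennreal s" by (rule ennreal_leI)
qed

lemma portion_subset: "portion w v \<subseteq> portion [] []"
  using cantor_subset by (auto simp: portion_def)

lemma qc_image_dim_ge:
  assumes "f \<in> qc_homeos"
  shows "2 \<le> hausdorff_dim (f ` portion [] [])"
proof -
  have sf: "f \<in> self_homeos" using assms by (simp add: qc_homeos_def)
  have "pt (lft []) (lft []) \<in> portion [] []"
    using lft_in_cantor[of "[]"] lft_in_cell[of "[]"] unfolding portion_def by blast
  then have "portion [] [] \<noteq> {}" by blast
  then obtain H \<rho> x0 \<epsilon> where H: "1 \<le> H" "0 < \<rho>" "x0 \<in> portion [] []" "0 < \<epsilon>"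
    and qs: "\<And>x. x \<in> portion [] [] \<Longrightarrow> dist x x0 < \<epsilon> \<Longrightarrow> weak_qs_at f H \<rho> x"
    using qc_weak_qs_portion[OF assms compact_imp_closed[OF compact_portion]] by blast
  have "\<forall>\<^sub>F n in sequentially. len n < min \<rho> (\<epsilon> / 2)"
    using H by (intro order_tendstoD(2)[OF len_tendsto_0]) auto
  then obtain n where n: "len n < \<rho>" "len n < \<epsilon> / 2" by (auto simp: eventually_sequentially)
  obtain a0 b0 where x0: "x0 = pt a0 b0" "a0 \<in> cantor" "b0 \<in> cantor" using H by (auto simp: portion_def)
  obtain w v where wv: "length w = n" "a0 \<in> cell w" "length v = n" "b0 \<in> cell v"
    using x0(2,3) unfolding cantor_def by blast
  have "weak_qs_at f H \<rho> p" if p: "p \<in> portion w v" for p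
  proof (rule qs)
    show "p \<in> portion [] []" using p portion_subset by blast
    obtain a b where ab: "p = pt a b" "a \<in> cell w" "b \<in> cell v" using p by (auto simp: portion_def)
    have "dist p x0 \<le> \<bar>a - a0\<bar> + \<bar>b - b0\<bar>" unfolding ab x0 by (rule dist_pt_le)
    also have "\<dots> \<le> len n + len n"
      using ab wv by (intro add_mono) (auto simp: cell_def abs_le_iff)
    finally show "dist p x0 < \<epsilon>" using n by linarith
  qed
  then obtain \<delta> where \<delta>: "0 < \<delta>" "\<delta> \<le> 1" "0 < hausdorff_premeasure 2 \<delta> (f ` portion w v)"
    using hausdorff_premeasure_portion_pos[OF sf H(1) n(1) wv(1,3)] by blast
  have "ennreal 2 \<le> hausdorff_dim (f ` portion [] [])"
    using \<delta> by (rule hausdorff_dim_geI) (intro image_mono portion_subset)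
  then show ?thesis by simp
qed

lemma id_qc: "(\<lambda>x. x) \<in> (qc_homeos :: ('a::euclidean_space \<Rightarrow> 'a) set)"
proof -
  have "metric_dilatation (\<lambda>x. x) x r = 1" if r: "0 < r" for x :: 'a and r
  proof -
    have "sphere x r \<noteq> {}" using r by simp
    then have "(SUP y\<in>sphere x r. ennreal (dist x y)) = ennreal r" "(INF y\<in>sphere x r. ennreal (dist x y)) = ennreal r"
      by (auto intro!: SUP_eq_const INF_eq_const)
    then show ?thesis using r by (simp add: metric_dilatation_def ennreal_divide_self)
  qed
  then have "Limsup (at_right 0) (metric_dilatation (\<lambda>x. x) x) \<le> 1" for x :: 'a
    by (intro Limsup_bounded) (auto simp: eventually_at_filter)
  moreover have "(\<lambda>x. x) \<in> (self_homeos :: ('a \<Rightarrow> 'a) set)"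
    unfolding self_homeos_def by (intro CollectI exI[of _ "\<lambda>x. x"]) (auto simp: homeomorphism_def)
  ultimately show ?thesis unfolding qc_homeos_def by (intro CollectI conjI exI[of _ 1]) auto
qed

text \<open>
  The \<open>4 ^ n\<close> squares of generation \<open>n\<close> serve as covers.
\<close>
lemma dim_image_portion_le:
  fixes f :: "real ^ 3 \<Rightarrow> real ^ 3"
  assumes small: "\<And>w v p q. length w = length v \<Longrightarrow> p \<in> portion w v \<Longrightarrow> q \<in> portion w v \<Longrightarrow> dist (f p) (f q) \<le> r (length w)"
    and r0: "\<And>n. 0 \<le> r n" and r: "r \<longlonglongrightarrow> 0" and t: "0 \<le> t"
    and lim: "\<And>s. t < s \<Longrightarrow> (\<lambda>n. 4 ^ n * r n powr s) \<longlonglongrightarrow> 0"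
  shows "hausdorff_dim (f ` portion [] []) \<le> ennreal t"
proof (rule hausdorff_dim_leI[OF t])
  fix s assume s: "t < s"
  show "hausdorff_outer_measure s (f ` portion [] []) = 0"
  proof (rule hausdorff_outer_measure_eq_0I[where N="\<lambda>n. 4 ^ n"])
    fix n
    let ?W = "{w :: bool list. length w = n}"
    define \<U> where "\<U> = (\<lambda>q. f ` portion (fst q) (snd q)) ` (?W \<times> ?W)"
    have "finite \<U>" unfolding \<U>_def by (intro finite_imageI finite_cartesian_product finite_words)
    moreover have "card \<U> \<le> 4 ^ n"
    proof -
      have "card \<U> \<le> card (?W \<times> ?W)"
        unfolding \<U>_def by (intro card_image_le finite_cartesian_product finite_words)
      also have "\<dots> = 4 ^ n" by (simp add: card_cartesian_product card_words flip: power_mult_distrib)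
      finally show ?thesis .
    qed
    moreover have "f ` portion [] [] \<subseteq> \<Union>\<U>"
    proof
      fix z assume "z \<in> f ` portion [] []"
      then obtain a b where ab: "a \<in> cantor" "b \<in> cantor" "z = f (pt a b)" by (auto simp: portion_def)
      obtain w v where "length w = n" "a \<in> cell w" "length v = n" "b \<in> cell v"
        using ab(1,2) unfolding cantor_def by blast
      with ab have "(w, v) \<in> ?W \<times> ?W" "pt a b \<in> portion w v" by (auto simp: portion_def)
      then have "z \<in> f ` portion w v" "f ` portion w v \<in> \<U>" using ab(3) unfolding \<U>_def by force+
      then show "z \<in> \<Union>\<U>" by blast
    qed
    moreover have "bounded V \<and> diameter V \<le> r n" if "V \<in> \<U>" for V
    proof -
      obtain w v where V: "V = f ` portion w v" "length w = n" "length v = n" using \<open>V \<in> \<U>\<close> by (auto simp: \<U>_def)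
      have d: "dist x y \<le> r n" if "x \<in> V" "y \<in> V" for x y
        using that small[of w v] V by auto
      then have "bounded V" unfolding bounded_two_points by blast
      moreover have "diameter V \<le> r n" by (rule diameter_le) (use d r0 in \<open>auto simp flip: dist_norm\<close>)
      ultimately show ?thesis by simp
    qed
    ultimately show "\<exists>\<U>. finite \<U> \<and> card \<U> \<le> 4 ^ n \<and> f ` portion [] [] \<subseteq> \<Union>\<U> \<and> (\<forall>V\<in>\<U>. bounded V \<and> diameter V \<le> r n)"
      by blast
  qed (use s t r lim[OF s] in auto)
qed

lemma dim_portion_le: "hausdorff_dim (portion [] []) \<le> 2"
proof -
  have "hausdorff_dim ((\<lambda>x. x) ` portion [] []) \<le> ennreal 2"
  proof (rule dim_image_portion_le[where r="\<lambda>n. 4 * (1/2) ^ n"])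
    fix w v p q assume l: "length w = length v" and "p \<in> portion w v" "q \<in> portion w v"
    then obtain a b a' b' where p: "p = pt a b" "a \<in> cell w" "b \<in> cell v" and q: "q = pt a' b'" "a' \<in> cell w" "b' \<in> cell v"
      by (auto simp: portion_def)
    have "dist p q \<le> \<bar>a - a'\<bar> + \<bar>b - b'\<bar>" unfolding p q by (rule dist_pt_le)
    also have "\<dots> \<le> len (length w) + len (length w)"
      using p q l by (intro add_mono) (auto simp: cell_def abs_le_iff)
    finally show "dist p q \<le> 4 * (1/2) ^ length w" using len_le[of "length w"] by linarith
  next
    fix s :: real assume "2 < s"
    then have "2 powr 2 < 2 powr s" by (intro powr_less_mono) auto
    then have "4 * (1/2) powr s < 1" by (simp add: powr_divide)
    then have "(\<lambda>n. 4 powr s * (4 * (1/2) powr s) ^ n) \<longlonglongrightarrow> 0"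
      by (intro tendsto_mult_right_zero LIMSEQ_realpow_zero) auto
    moreover have "4 ^ n * (4 * (1/2) ^ n) powr s = 4 powr s * (4 * (1/2) powr s) ^ n" for n
    proof -
      have "((1/2) ^ n) powr s = ((1/2::real) powr s) ^ n"
        by (simp add: powr_realpow[symmetric] powr_powr mult.commute)
      then show ?thesis by (simp add: powr_mult power_mult_distrib)
    qed
    ultimately show "(\<lambda>n. 4 ^ n * (4 * (1/2) ^ n) powr s) \<longlonglongrightarrow> 0" by (simp only:)
  next
    show "(\<lambda>n. 4 * (1/2::real) ^ n) \<longlonglongrightarrow> 0" by real_asymp
  qed auto
  then show ?thesis by simp
qed

lemma excess_powr_lim:
  assumes "0 < s"
  shows "(\<lambda>n. 4 ^ n * (2 * excess n) powr s) \<longlonglongrightarrow> 0"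
  unfolding excess_def using assms by real_asymp

lemma excess_lim: "(\<lambda>n. 2 * excess n) \<longlonglongrightarrow> 0"
  unfolding excess_def by real_asymp

section \<open>Squeezing the Cantor product to dimension zero\<close>

text \<open>
  The union of the intervals \<open>k\<close> generations below \<open>w\<close>. These unions decrease to the part of the
  Cantor set in \<open>w\<close>, whose length is therefore a limit of explicit numbers.
\<close>
primrec cyl :: "nat \<Rightarrow> bool list \<Rightarrow> real set" where
  "cyl 0 w = cell w"
| "cyl (Suc k) w = cyl k (False # w) \<union> cyl k (True # w)"

lemma cyl_subset_cell: "cyl k w \<subseteq> cell w"
proof (induction k arbitrary: w)
  case (Suc k)
  show ?case using Suc[of "False # w"] Suc[of "True # w"] cell_Cons[of False w] cell_Cons[of True w] by auto
qed simp

lemma cyl_Suc_subset: "cyl (Suc k) w \<subseteq> cyl k w"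
proof (induction k arbitrary: w)
  case 0
  show ?case using cell_Cons[of False w] cell_Cons[of True w] by auto
next
  case (Suc k)
  show ?case using Suc[of "False # w"] Suc[of "True # w"] by auto
qed

lemma in_cylD: "x \<in> cyl k w \<Longrightarrow> \<exists>p. length p = k \<and> x \<in> cell (p @ w)"
proof (induction k arbitrary: w)
  case (Suc k)
  then obtain b where "x \<in> cyl k (b # w)" by auto
  then obtain p where "length p = k" "x \<in> cell (p @ (b # w))" using Suc.IH by blast
  then show ?case by (intro exI[of _ "p @ [b]"]) simp
qed simp

lemma cyl_sets [measurable]: "cyl k w \<in> sets borel"
  by (induction k arbitrary: w) (auto simp: cell_def)

lemma emeasure_cyl_finite: "emeasure lborel (cyl k w) \<noteq> \<infinity>"
proof -
  have "bounded (cyl k w)"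
    using cyl_subset_cell[of k w] by (rule bounded_subset[rotated]) (simp add: cell_def)
  then show ?thesis using emeasure_bounded_finite by (auto simp: less_top)
qed

lemma measure_cyl: "measure lborel (cyl k w) = 2 ^ k * len (k + length w)"
proof (induction k arbitrary: w)
  case 0
  show ?case using len_pos[of "length w"] by (simp add: cell_def)
next
  case (Suc k)
  have "cyl k (False # w) \<inter> cyl k (True # w) = {}"
    using cyl_subset_cell[of k "False # w"] cyl_subset_cell[of k "True # w"] cell_inj[of "False # w" "True # w"] by auto
  then have "measure lborel (cyl (Suc k) w) = measure lborel (cyl k (False # w)) + measure lborel (cyl k (True # w))"
    using emeasure_cyl_finite by (simp add: measure_Union)
  then show ?case by (simp add: Suc)
qed

lemma measure_cantor_cell_ge: "(1/2) ^ length w \<le> measure lborel (cantor \<inter> cell w)"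
proof -
  have dec: "decseq (\<lambda>k. cyl k w)" using cyl_Suc_subset by (rule decseq_SucI)
  have "(\<lambda>k. measure lborel (cyl k w)) \<longlonglongrightarrow> measure lborel (\<Inter>k. cyl k w)"
    by (rule Lim_measure_decseq) (use dec emeasure_cyl_finite in auto)
  moreover have "(1/2) ^ length w \<le> measure lborel (cyl k w)" for k
    using mult_left_mono[OF len_ge[of "k + length w"], of "2 ^ k"]
    by (simp add: measure_cyl power_add power_one_over)
  ultimately have "(1/2) ^ length w \<le> measure lborel (\<Inter>k. cyl k w)"
    by (intro LIMSEQ_le_const) auto
  also have "\<dots> \<le> measure lborel (cantor \<inter> cell w)"
  proof (rule measure_mono_fmeasurable)
    show "(\<Inter>k. cyl k w) \<subseteq> cantor \<inter> cell w"
    proof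
      fix x assume x: "x \<in> (\<Inter>k. cyl k w)"
      then have "x \<in> cyl 0 w" by blast
      moreover have "x \<in> cantor" using x by (intro in_cantorI[of x w] in_cylD) auto
      ultimately show "x \<in> cantor \<inter> cell w" by simp
    qed
    show "cantor \<inter> cell w \<in> fmeasurable lborel"
      by (intro fmeasurable_compact compact_Int_closed compact_cantor) (simp add: cell_def)
  qed measurable
  finally show ?thesis .
qed

lemma cantor_gap:
  assumes "x < y"
  obtains p q where "x \<le> p" "p < q" "q \<le> y" "{p<..<q} \<inter> cantor = {}"
proof (cases "{x<..<y} \<inter> cantor = {}")
  case True
  then show ?thesis using that[of x y] assms by simp
next
  case False
  then obtain z where z: "z \<in> cantor" "x < z" "z < y" by auto
  have "\<forall>\<^sub>F n in sequentially. len n < min (z - x) (y - z)"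
    using z by (intro order_tendstoD(2)[OF len_tendsto_0]) auto
  then obtain n where n: "len n < z - x" "len n < y - z" by (auto simp: eventually_sequentially)
  obtain w where w: "length w = n" "z \<in> cell w" using z(1) unfolding cantor_def by blast
  show ?thesis
  proof (rule that[of "lft w + len (Suc n)" "lft (True # w)"])
    show "x \<le> lft w + len (Suc n)" "lft (True # w) \<le> y"
      using n w len_pos[of "Suc n"] by (auto simp: cell_def)
    show "lft w + len (Suc n) < lft (True # w)" using len_Suc[of n] w by simp
    show "{lft w + len (Suc n)<..<lft (True # w)} \<inter> cantor = {}"
    proof (rule ccontr)
      assume "\<not> ?thesis"
      then obtain t where t: "t \<in> cantor" "lft w + len (Suc n) < t" "t < lft (True # w)" by auto
      then have "t \<in> cell w" using w len_pos[of "Suc n"] by (auto simp: cell_def)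
      then obtain b where "t \<in> cell (b # w)" using cantor_child t(1) by blast
      then show False using t w by (cases b) (auto simp: cell_def)
    qed
  qed
qed

text \<open>
  Collapses the length of the Cantor set. The map is strictly increasing because the Cantor set
  contains no interval, and an interval of generation \<open>n\<close> loses at least \<open>(1/2) ^ n\<close> of its length,
  so that at most \<open>excess n\<close> remains.
\<close>
definition squeeze :: "real \<Rightarrow> real" where
  "squeeze x = x - measure lborel (cantor \<inter> {..x})"

lemma cantor_Int_fmeasurable: "S \<in> sets borel \<Longrightarrow> cantor \<inter> S \<in> fmeasurable lborel"
  using fmeasurable_compact[OF compact_cantor] by (intro fmeasurable_Int_fmeasurable) auto

lemma squeeze_diff:
  assumes "x \<le> y"
  shows "squeeze y - squeeze x = (y - x) - measure lborel (cantor \<inter> {x<..y})"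
proof -
  have "cantor \<inter> {..y} = (cantor \<inter> {..x}) \<union> (cantor \<inter> {x<..y})" using assms by auto
  moreover have "measure lborel ((cantor \<inter> {..x}) \<union> (cantor \<inter> {x<..y})) =
      measure lborel (cantor \<inter> {..x}) + measure lborel (cantor \<inter> {x<..y})"
    using cantor_Int_fmeasurable[of "{..x}"] cantor_Int_fmeasurable[of "{x<..y}"]
    by (intro measure_Union) (auto simp: fmeasurable_def less_top)
  ultimately show ?thesis by (simp add: squeeze_def)
qed

lemma squeeze_lipschitz: "x \<le> y \<Longrightarrow> squeeze y - squeeze x \<le> y - x"
  by (simp add: squeeze_diff)

lemma squeeze_strict_mono: "x < y \<Longrightarrow> squeeze x < squeeze y"
proof -
  assume "x < y"
  then obtain p q where pq: "x \<le> p" "p < q" "q \<le> y" "{p<..<q} \<inter> cantor = {}" by (rule cantor_gap)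
  have "measure lborel (cantor \<inter> {x<..y}) \<le> measure lborel ({x..p} \<union> {q..y})"
  proof (rule measure_mono_fmeasurable)
    show "cantor \<inter> {x<..y} \<subseteq> {x..p} \<union> {q..y}" using pq(4) by force
    show "cantor \<inter> {x<..y} \<in> sets lborel" using cantor_Int_fmeasurable[of "{x<..y}"] by (auto dest: fmeasurableD)
    show "{x..p} \<union> {q..y} \<in> fmeasurable lborel" by (intro fmeasurable_compact compact_Un) auto
  qed
  also have "\<dots> \<le> measure lborel {x..p} + measure lborel {q..y}"
    by (intro measure_Un_le) auto
  also have "\<dots> = (p - x) + (y - q)" using pq by simp
  finally show "squeeze x < squeeze y"
    using squeeze_diff[of x y] \<open>x < y\<close> pq by simp
qed

lemma squeeze_mono: "x \<le> y \<Longrightarrow> squeeze x \<le> squeeze y"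
  using squeeze_strict_mono[of x y] by (cases "x = y") auto

lemma inj_squeeze: "inj squeeze"
  by (rule injI) (metis squeeze_strict_mono linorder_neqE_linordered_idom order_less_irrefl)

lemma continuous_squeeze: "continuous_on S squeeze"
proof (rule continuous_on_subset[of UNIV])
  have "\<bar>squeeze x - squeeze y\<bar> \<le> \<bar>x - y\<bar>" for x y
    using squeeze_lipschitz[of x y] squeeze_lipschitz[of y x] squeeze_mono[of x y] squeeze_mono[of y x]
    by (cases "x \<le> y") auto
  then show "continuous_on UNIV squeeze"
    unfolding continuous_on_iff dist_real_def by (meson order_le_less_trans)
qed simp

lemma surj_squeeze: "surj squeeze"
unfolding surj_def
proof
  fix y
  define m where "m = measure lborel cantor"
  have le: "measure lborel (cantor \<inter> {..x}) \<le> m" for x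
    unfolding m_def using fmeasurable_compact[OF compact_cantor] cantor_Int_fmeasurable[of "{..x}"]
    by (intro measure_mono_fmeasurable) (auto dest: fmeasurableD)
  have "squeeze y \<le> y" by (simp add: squeeze_def)
  moreover have "y \<le> squeeze (y + m)" using le[of "y + m"] by (simp add: squeeze_def)
  moreover have "y \<le> y + m" by (simp add: m_def)
  ultimately show "\<exists>x. y = squeeze x"
    using IVT'[of squeeze y y "y + m"] continuous_squeeze by blast
qed

lemma squeeze_cell:
  assumes "a \<in> cell w" "a' \<in> cell w"
  shows "\<bar>squeeze a - squeeze a'\<bar> \<le> excess (length w)"
proof -
  let ?l = "lft w" and ?r = "lft w + len (length w)"
  have l: "?l \<le> ?r" using len_pos[of "length w"] by simp
  have "(1/2) ^ length w \<le> measure lborel (cantor \<inter> cell w)" by (rule measure_cantor_cell_ge)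
  also have "\<dots> \<le> measure lborel ((cantor \<inter> {?l<..?r}) \<union> {?l})"
  proof (rule measure_mono_fmeasurable)
    show "cantor \<inter> cell w \<subseteq> (cantor \<inter> {?l<..?r}) \<union> {?l}" by (auto simp: cell_def)
    show "cantor \<inter> cell w \<in> sets lborel" using cantor_Int_fmeasurable[of "cell w"] by (auto dest: fmeasurableD simp: cell_def)
    show "(cantor \<inter> {?l<..?r}) \<union> {?l} \<in> fmeasurable lborel"
      by (intro fmeasurable.Un cantor_Int_fmeasurable fmeasurable_compact) auto
  qed
  also have "\<dots> \<le> measure lborel (cantor \<inter> {?l<..?r}) + measure lborel {?l}"
    using cantor_Int_fmeasurable[of "{?l<..?r}"] by (intro measure_Un_le) (auto dest: fmeasurableD)
  also have "measure lborel {?l} = 0" by simp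
  finally have "squeeze ?r - squeeze ?l \<le> excess (length w)"
    using squeeze_diff[OF l] by (simp add: len_def)
  moreover have "squeeze ?l \<le> squeeze a" "squeeze a \<le> squeeze ?r" "squeeze ?l \<le> squeeze a'" "squeeze a' \<le> squeeze ?r"
    using assms by (auto simp: cell_def intro!: squeeze_mono)
  ultimately show ?thesis by linarith
qed

definition squeeze_plane :: "real ^ 3 \<Rightarrow> real ^ 3" where
  "squeeze_plane x = (\<chi> i. if i = 3 then x $ i else squeeze (x $ i))"

text \<open>
  The map is a continuous bijection because \<open>squeeze\<close> is one, and continuous bijections of Euclidean
  space are homeomorphisms by invariance of domain.
\<close>
lemma squeeze_plane_homeo: "squeeze_plane \<in> self_homeos"
proof -
  have comp: "continuous_on UNIV (\<lambda>x :: real ^ 3. squeeze (x $ i))" for i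
    by (rule continuous_on_compose2[OF continuous_squeeze[of UNIV]]) (auto intro: continuous_intros)
  have "continuous_on UNIV (\<lambda>x :: real ^ 3. if i = 3 then x $ i else squeeze (x $ i))" for i
    using comp[of i] by (cases "i = 3") (auto intro: continuous_intros)
  then have cont: "continuous_on UNIV squeeze_plane"
    unfolding squeeze_plane_def by (intro continuous_on_vec_lambda)
  have inj: "inj squeeze_plane"
  proof (rule injI)
    fix x y assume eq: "squeeze_plane x = squeeze_plane y"
    have "x $ i = y $ i" for i
      using arg_cong[OF eq, of "\<lambda>v. v $ i"] injD[OF inj_squeeze, of "x $ i" "y $ i"]
      by (cases "i = 3") (simp_all add: squeeze_plane_def)
    then show "x = y" by (simp add: vec_eq_iff)
  qed
  have "surj squeeze_plane"
    unfolding surj_def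
  proof
    fix y
    have "y = squeeze_plane (\<chi> i. if i = 3 then y $ i else inv squeeze (y $ i))"
      by (simp add: vec_eq_iff squeeze_plane_def surj_f_inv_f[OF surj_squeeze])
    then show "\<exists>x. y = squeeze_plane x" by blast
  qed
  moreover obtain g where "homeomorphism UNIV (squeeze_plane ` UNIV) squeeze_plane g"
    using invariance_of_domain_homeomorphism[OF open_UNIV cont _ inj] by auto
  ultimately show ?thesis unfolding self_homeos_def by auto
qed

lemma squeeze_plane_pt: "squeeze_plane (pt a b) = pt (squeeze a) (squeeze b)"
  by (simp add: vec_eq_iff forall_3 squeeze_plane_def pt_def)

lemma dim_squeeze_plane_portion: "hausdorff_dim (squeeze_plane ` portion [] []) = 0"
proof -
  have "hausdorff_dim (squeeze_plane ` portion [] []) \<le> ennreal 0"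
  proof (rule dim_image_portion_le[where r="\<lambda>n. 2 * excess n"])
    fix w v p q assume l: "length w = length v" and "p \<in> portion w v" "q \<in> portion w v"
    then obtain a b a' b' where p: "p = pt a b" "a \<in> cell w" "b \<in> cell v" and q: "q = pt a' b'" "a' \<in> cell w" "b' \<in> cell v"
      by (auto simp: portion_def)
    have "dist (squeeze_plane p) (squeeze_plane q) \<le> \<bar>squeeze a - squeeze a'\<bar> + \<bar>squeeze b - squeeze b'\<bar>"
      unfolding p q squeeze_plane_pt by (rule dist_pt_le)
    also have "\<dots> \<le> 2 * excess (length w)"
      using squeeze_cell[OF p(2) q(2)] squeeze_cell[OF p(3) q(3)] l by simp
    finally show "dist (squeeze_plane p) (squeeze_plane q) \<le> 2 * excess (length w)" .
  next
    fix s :: real assume "0 < s"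
    then show "(\<lambda>n. 4 ^ n * (2 * excess n) powr s) \<longlonglongrightarrow> 0" by (rule excess_powr_lim)
  qed (rule excess_lim | simp add: less_imp_le[OF excess_pos])+
  then show ?thesis by simp
qed

theorem corollary1p3:
  shows "\<exists>E :: (real ^ 3) set.
    compact E \<and> hausdorff_dim E = 2 \<and> qc_dim E = 2 \<and> homeo_dim E = 0"
proof (intro exI conjI)
  let ?E = "portion [] []"
  show "compact ?E" by (rule compact_portion)
  have ge: "2 \<le> qc_dim ?E"
    unfolding qc_dim_def by (intro INF_greatest qc_image_dim_ge)
  have le: "qc_dim ?E \<le> hausdorff_dim ?E"
    unfolding qc_dim_def using INF_lower[OF id_qc, of "\<lambda>f. hausdorff_dim (f ` ?E)"] by simp
  show "hausdorff_dim ?E = 2" "qc_dim ?E = 2"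
    using ge le dim_portion_le by (auto intro: antisym order_trans)
  have "homeo_dim ?E \<le> 0"
    unfolding homeo_dim_def
    using INF_lower[OF squeeze_plane_homeo, of "\<lambda>f. hausdorff_dim (f ` ?E)"] by (simp add: dim_squeeze_plane_portion)
  then show "homeo_dim ?E = 0" by simp
qed

end
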